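(* Fix a team $i$ with action space $\mathbb U^i$ and observation space $\mathbb Y^i$ as in the context, and let $N_i\in\mathbb N$. If $\mathbb U^i$ is compact, then the set $L^i_{\mathrm{EX},N}$ of exchangeable randomized policies for $N_i$ decision makers and the set $L^i_{\mathrm{EX}}$ of infinitely exchangeable randomized policies for countably infinitely many decision makers are convex and compact (in the weak convergence topology).
   Context: $\mathbb U^i\subseteq\mathbb R^{n_i}$ and $\mathbb Y^i\subseteq\mathbb R^{m_i}$ are Borel, and $Q^i$ is a fixed probability measure on $\mathbb Y^i$. $\mathcal P(\cdot)$ denotes the Borel probability measures on a space. For each decision maker $k$, $\Gamma^i_k$ (the same set for all $k$) is the set of stochastic kernels $\gamma^i_k(du\mid y)$ from $\mathbb Y^i$ to $\mathbb U^i$, identified with the measures $\gamma^i_k(du\mid y)Q^i(dy)\in\mathcal P(\mathbb U^i\times\mathbb Y^i)$ and given the weak convergence topology on these measures, with its Borel $\sigma$-field. Randomized policies: $L^i_N=\mathcal P(\prod_{k=1}^{N_i}\Gamma^i_k)$ and $L^i=\mathcal P(\prod_{k\in\mathbb N}\Gamma^i_k)$ (product topologies), each with the weak convergence topology. $L^i_{\mathrm{EX},N}$ is the set of $P_\pi\in L^i_N$ such that for all $A_k\in\mathcal B(\Gamma^i_k)$ and all permutations $\sigma$ of $\{1,\dots,N_i\}$, $$P_\pi(\gamma^i_1\in A_1,\dots,\gamma^i_{N_i}\in A_{N_i})=P_\pi(\gamma^i_{\sigma(1)}\in A_1,\dots,\gamma^i_{\sigma(N_i)}\in A_{N_i}).$$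 $L^i_{\mathrm{EX}}$ is the set of $P_\pi\in L^i$ such that this equality holds for every $N_i\in\mathbb N$, all $A_k\in\mathcal B(\Gamma^i_k)$ and all permutations $\sigma$ of $\{1,\dots,N_i\}$. *)

theory Defs
  imports "HOL-Probability.Probability"
begin

definition borel_of :: "'a topology \<Rightarrow> 'a measure" where
  "borel_of X = sigma (topspace X) {S. openin X S}"

definition borel_prob :: "'a topology \<Rightarrow> 'a measure set" where
  "borel_prob X = {M. prob_space M \<and> sets M = sets (borel_of X)}"

text \<open>
  The weak convergence topology on the Borel probability measures of \<open>X\<close>: the coarsest topology
  that makes \<open>\<mu> \<mapsto> \<integral> f d\<mu>\<close> continuous for every bounded continuous real function \<open>f\<close> on \<open>X\<close>.
\<close>
definition weak_topology :: "'a topology \<Rightarrow> 'a measure topology" where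
  "weak_topology X = topology_generated_by
     {{M \<in> borel_prob X. (\<integral>x. f x \<partial>M) \<in> G} | f G.
        continuous_map X euclideanreal f \<and> bounded (f ` topspace X) \<and> open G}"

lemma space_borel_of [simp]: "space (borel_of X) = topspace X"
  by (simp add: borel_of_def space_measure_of_conv)

lemma sets_borel_of: "sets (borel_of X) = sigma_sets (topspace X) {S. openin X S}"
  unfolding borel_of_def by (rule sets_measure_of) (auto dest: openin_subset)

lemma sets_borel_of_top_of_set:
  "sets (borel_of (top_of_set S)) = sets (restrict_space borel S)"
proof -
  have "sets (restrict_space borel S)
      = {(\<lambda>x. x) -` T \<inter> S | T. T \<in> sigma_sets UNIV {T. open T}}"
    by (auto simp: sets_restrict_space borel_def)
  also have "\<dots> = sigma_sets S {(\<lambda>x. x) -` T \<inter> S | T. T \<in> {T. open T}}"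
    by (rule sigma_sets_vimage_commute) simp
  also have "{(\<lambda>x. x) -` T \<inter> S | T. T \<in> {T. open T}} = {T. openin (top_of_set S) T}"
    by (auto simp: openin_open)
  finally show ?thesis by (simp add: sets_borel_of)
qed

lemma topspace_weak_topology [simp]: "topspace (weak_topology X) = borel_prob X"
proof -
  have "borel_prob X = {M \<in> borel_prob X. (\<integral>x. 0 \<partial>M) \<in> (UNIV :: real set)}" by simp
  moreover have "bounded ((\<lambda>x::'a. 0::real) ` topspace X)"
    by (rule finite_imp_bounded) (auto intro: finite_subset [of _ "{0}"])
  ultimately show ?thesis
    unfolding weak_topology_def topology_generated_by_topspace
    by (fastforce simp: continuous_map_const intro!: exI [of _ "\<lambda>_. 0"] exI [of _ UNIV])
qed

definition mix_measure :: "real \<Rightarrow> 'a measure \<Rightarrow> 'a measure \<Rightarrow> 'a measure" where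
  "mix_measure t M N = measure_of (space M) (sets M)
     (\<lambda>A. ennreal t * emeasure M A + ennreal (1 - t) * emeasure N A)"

lemma sets_mix_measure [simp]: "sets (mix_measure t M N) = sets M"
  by (simp add: mix_measure_def)

lemma emeasure_mix_measure:
  assumes "sets M = sets N" "A \<in> sets M"
  shows "emeasure (mix_measure t M N) A
           = ennreal t * emeasure M A + ennreal (1 - t) * emeasure N A"
  unfolding mix_measure_def
proof (rule emeasure_measure_of_sigma [OF sets.sigma_algebra_axioms _ _ assms(2)])
  show "positive (sets M) (\<lambda>A. ennreal t * emeasure M A + ennreal (1 - t) * emeasure N A)"
    by (simp add: positive_def)
  show "countably_additive (sets M)
          (\<lambda>A. ennreal t * emeasure M A + ennreal (1 - t) * emeasure N A)"
    using assms(1)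
    by (auto simp: countably_additive_def suminf_emeasure subset_eq
             simp flip: suminf_add [OF summableI summableI])
qed

text \<open>Measures do not form a real vector space, so \<^const>\<open>convex\<close> does not apply.\<close>
definition convex_measures :: "'a measure set \<Rightarrow> bool" where
  "convex_measures S \<longleftrightarrow> (\<forall>M\<in>S. \<forall>N\<in>S. \<forall>t\<in>{0..1}. mix_measure t M N \<in> S)"

text \<open>The measure \<open>\<gamma>(du|y) Q(dy)\<close> on \<open>U \<times> Y\<close>.\<close>
definition joint_measure ::
    "'u::topological_space set \<Rightarrow> 'y::topological_space set \<Rightarrow> 'y measure \<Rightarrow>
     ('y \<Rightarrow> 'u measure) \<Rightarrow> ('u \<times> 'y) measure" where
  "joint_measure U Y Q \<gamma> =
     Q \<bind> (\<lambda>y. distr (\<gamma> y) (borel_of (top_of_set (U \<times> Y))) (\<lambda>u. (u, y)))"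

lemma emeasure_joint_measure:
  fixes U :: "'u::second_countable_topology set" and Y :: "'y::second_countable_topology set"
  assumes Q: "Q \<in> borel_prob (top_of_set Y)"
    and \<gamma>: "\<gamma> \<in> borel_of (top_of_set Y) \<rightarrow>\<^sub>M prob_algebra (borel_of (top_of_set U))"
    and A: "A \<in> sets (borel_of (top_of_set U))" and B: "B \<in> sets (borel_of (top_of_set Y))"
  shows "emeasure (joint_measure U Y Q \<gamma>) (A \<times> B)
           = (\<integral>\<^sup>+y. emeasure (\<gamma> y) A * indicator B y \<partial>Q)"
proof -
  let ?R = "borel_of (top_of_set (U \<times> Y))"
  let ?MU = "borel_of (top_of_set U)" and ?MY = "borel_of (top_of_set Y)"
  have setsQ [measurable_cong]: "sets Q = sets ?MY" and "prob_space Q"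
    using Q by (auto simp: borel_prob_def)
  interpret prob_space Q by fact
  have R: "sets ?R = sets (restrict_space (borel \<Otimes>\<^sub>M borel) (U \<times> Y))"
    unfolding sets_borel_of_top_of_set borel_prod ..
  have ident: "(\<lambda>x. x) \<in> borel_of (top_of_set S) \<rightarrow>\<^sub>M borel" for S :: "'z::topological_space set"
    unfolding measurable_cong_sets [OF sets_borel_of_top_of_set refl]
    by (rule measurable_restrict_space1) simp
  have "(\<lambda>(y, u). (u, y)) \<in> ?MY \<Otimes>\<^sub>M ?MU \<rightarrow>\<^sub>M borel \<Otimes>\<^sub>M borel"
    unfolding split_beta
    by (intro measurable_Pair measurable_compose [OF measurable_snd ident]
        measurable_compose [OF measurable_fst ident])
  then have swap: "(\<lambda>(y, u). (u, y)) \<in> ?MY \<Otimes>\<^sub>M ?MU \<rightarrow>\<^sub>M ?R"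
    unfolding measurable_cong_sets [OF refl R]
    by (intro measurable_restrict_space2) (auto simp: space_pair_measure)
  have kernel: "(\<lambda>y. distr (\<gamma> y) ?R (\<lambda>u. (u, y))) \<in> Q \<rightarrow>\<^sub>M subprob_algebra ?R"
    unfolding measurable_cong_sets [OF setsQ refl]
    using swap measurable_prob_algebraD [OF \<gamma>] by (rule measurable_distr2)
  obtain A' B' where A': "A' \<in> sets borel" "A = U \<inter> A'" and B': "B' \<in> sets borel" "B = Y \<inter> B'"
    using A B by (auto simp: sets_borel_of_top_of_set sets_restrict_space)
  have "A \<times> B = (U \<times> Y) \<inter> (A' \<times> B')"
    using A' B' by auto
  then have AB: "A \<times> B \<in> sets ?R"
    unfolding R sets_restrict_space using A' B' by blast
  have "emeasure (distr (\<gamma> y) ?R (\<lambda>u. (u, y))) (A \<times> B) = emeasure (\<gamma> y) A * indicator B y"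
    if y: "y \<in> space Q" for y
  proof -
    have y': "y \<in> space ?MY"
      using y sets_eq_imp_space_eq [OF setsQ] by simp
    have sg: "sets (\<gamma> y) = sets ?MU"
      using measurable_space [OF \<gamma> y'] by (simp add: space_prob_algebra)
    have "(\<lambda>u. (u, y)) \<in> \<gamma> y \<rightarrow>\<^sub>M ?R"
      unfolding measurable_cong_sets [OF sg refl]
      using measurable_compose [OF measurable_Pair1' [OF y'] swap] by simp
    moreover have "(\<lambda>u. (u, y)) -` (A \<times> B) \<inter> space (\<gamma> y) = (if y \<in> B then A else {})"
      using A' sets_eq_imp_space_eq [OF sg] by auto
    ultimately show ?thesis
      using AB by (simp add: emeasure_distr)
  qed
  then show ?thesis
    unfolding joint_measure_def
    by (subst emeasure_bind [OF not_empty kernel AB]) (rule nn_integral_cong)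
qed

text \<open>
  Stochastic kernels enter only through their joint measures, so kernels that agree
  \<open>Q\<close>-almost everywhere are the same policy.
\<close>
definition policies ::
    "'u::topological_space set \<Rightarrow> 'y::topological_space set \<Rightarrow> 'y measure \<Rightarrow>
     ('u \<times> 'y) measure set" where
  "policies U Y Q = joint_measure U Y Q `
     (borel_of (top_of_set Y) \<rightarrow>\<^sub>M prob_algebra (borel_of (top_of_set U)))"

definition policy_topology ::
    "'u::topological_space set \<Rightarrow> 'y::topological_space set \<Rightarrow> 'y measure \<Rightarrow>
     ('u \<times> 'y) measure topology" where
  "policy_topology U Y Q =
     subtopology (weak_topology (top_of_set (U \<times> Y))) (policies U Y Q)"

text \<open>
  The product of copies of the policy space over an index set \<open>I\<close> of decision makers; \<open>I\<close> is
  \<open>{1..N}\<close> for \<open>N\<close> decision makers and \<open>{1..}\<close> for countably infinitely many.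
\<close>
definition team_topology ::
    "'u::topological_space set \<Rightarrow> 'y::topological_space set \<Rightarrow> 'y measure \<Rightarrow> nat set \<Rightarrow>
     (nat \<Rightarrow> ('u \<times> 'y) measure) topology" where
  "team_topology U Y Q I = product_topology (\<lambda>_. policy_topology U Y Q) I"

definition randomized_policies ::
    "'u::topological_space set \<Rightarrow> 'y::topological_space set \<Rightarrow> 'y measure \<Rightarrow> nat set \<Rightarrow>
     (nat \<Rightarrow> ('u \<times> 'y) measure) measure set" where
  "randomized_policies U Y Q I = borel_prob (team_topology U Y Q I)"

definition exchangeable_upto ::
    "'a measure \<Rightarrow> nat \<Rightarrow> (nat \<Rightarrow> 'a) measure \<Rightarrow> bool" where
  "exchangeable_upto B N P \<longleftrightarrow>
     (\<forall>A \<sigma>. (\<forall>k\<in>{1..N}. A k \<in> sets B) \<longrightarrow> \<sigma> permutes {1..N} \<longrightarrow>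
        measure P {\<gamma> \<in> space P. \<forall>k\<in>{1..N}. \<gamma> k \<in> A k} =
        measure P {\<gamma> \<in> space P. \<forall>k\<in>{1..N}. \<gamma> (\<sigma> k) \<in> A k})"

definition L_EX_fin ::
    "'u::topological_space set \<Rightarrow> 'y::topological_space set \<Rightarrow> 'y measure \<Rightarrow> nat \<Rightarrow>
     (nat \<Rightarrow> ('u \<times> 'y) measure) measure set" where
  "L_EX_fin U Y Q N = {P \<in> randomized_policies U Y Q {1..N}.
     exchangeable_upto (borel_of (policy_topology U Y Q)) N P}"

definition L_EX ::
    "'u::topological_space set \<Rightarrow> 'y::topological_space set \<Rightarrow> 'y measure \<Rightarrow>
     (nat \<Rightarrow> ('u \<times> 'y) measure) measure set" where
  "L_EX U Y Q = {P \<in> randomized_policies U Y Q {1..}.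
     \<forall>N. exchangeable_upto (borel_of (policy_topology U Y Q)) N P}"

end

theory Submission
  imports Defs "HOL-Library.Countable"
begin

text \<open>
  Identify a probability measure with the positive normalized functional it defines on bounded
  continuous functions. Such functionals form a compact set by Tychonoff's theorem, and by Daniell's
  theorem those that are continuous along decreasing sequences come from measures, so a set of
  measures given by integral constraints is weakly compact as soon as the constraints force this
  continuity. On a compact space it is automatic (Dini). For the joint measures on \<open>U \<times> Y\<close> with
  marginal \<open>Q\<close> it follows by replacing a function of \<open>(u, y)\<close> by its supremum over the compact set
  \<open>U\<close>, and by disintegration these joint measures are exactly the policies. Hence the policy space,
  its powers and the randomized policies over them are compact. Exchangeability amounts to the
  equalities \<open>\<integral> f(\<gamma> \<circ> \<sigma>) dP = \<integral> f dP\<close> for continuous \<open>f\<close>, which define a closed set.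
\<close>

section \<open>Daniell's theorem\<close>

text \<open>Positivity, additivity and integral constraints survive pointwise limits of functionals;
  continuity along decreasing sequences does not. On \<open>U \<times> Y\<close>, which may be
  noncompact, mass can escape in the limit. The marginal \<open>Q\<close> prevents this: on
  functions of \<open>y\<close> alone the functional is integration against a genuine measure. The
  function lattices are closed under sums, negation and maxima but need not contain real multiples,
  so a countable lattice qualifies. The disintegration relies on one: each property of a conditional
  expectation holds off a null set, and only countably many null sets can be discarded at once. The
  price is that all factors are integers and all thresholds rational. Daniell's theorem yields a
  measure on the sigma-algebra generated by the functions, while policies and exchangeability speak
  of Borel sets. The two agree on Euclidean subsets; they agree on the policy space and its powers
  because countably many integrals separate points there, which makes these compact spaces
  metrizable.\<close>

locale function_lattice =
  fixes \<Omega> :: "'a set" and L :: "('a \<Rightarrow> real) set"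
  assumes one: "(\<lambda>_. 1) \<in> L"
    and add: "f \<in> L \<Longrightarrow> g \<in> L \<Longrightarrow> (\<lambda>x. f x + g x) \<in> L"
    and uminus: "f \<in> L \<Longrightarrow> (\<lambda>x. - f x) \<in> L"
    and max: "f \<in> L \<Longrightarrow> g \<in> L \<Longrightarrow> (\<lambda>x. max (f x) (g x)) \<in> L"
    and bounded: "f \<in> L \<Longrightarrow> \<exists>B. \<forall>x\<in>\<Omega>. \<bar>f x\<bar> \<le> B"
begin

text \<open>The cozero sets of the family. For all bounded continuous functions they generate the
  Baire sigma-algebra.\<close>

definition positivity_sets :: "'a set set" where
  "positivity_sets = {{x \<in> \<Omega>. 0 < f x} | f. f \<in> L}"

text \<open>As \<open>n\<close> grows this increases to the indicator of
  \<open>{x. 0 < f x}\<close>. The natural factor and the cut at 1 keep it inside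
  \<open>L\<close>.\<close>

definition clip :: "nat \<Rightarrow> ('a \<Rightarrow> real) \<Rightarrow> 'a \<Rightarrow> real" where
  "clip n f x = min 1 (real n * max 0 (f x))"

lemma diff: "f \<in> L \<Longrightarrow> g \<in> L \<Longrightarrow> (\<lambda>x. f x - g x) \<in> L"
  using add [OF _ uminus, of f g] by simp

lemma zero: "(\<lambda>_. 0) \<in> L"
  using diff [OF one one] by simp

lemma min: "f \<in> L \<Longrightarrow> g \<in> L \<Longrightarrow> (\<lambda>x. min (f x) (g x)) \<in> L"
proof -
  assume "f \<in> L" "g \<in> L"
  then have "(\<lambda>x. - max (- f x) (- g x)) \<in> L"
    by (intro uminus max)
  then show ?thesis
    by (simp add: minus_max_eq_min)
qed

lemma scale_nat: "f \<in> L \<Longrightarrow> (\<lambda>x. real n * f x) \<in> L"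
  by (induction n) (auto simp: zero distrib_right intro: add)

lemma scale_int: "f \<in> L \<Longrightarrow> (\<lambda>x. of_int k * f x) \<in> L"
proof (cases k rule: int_cases2)
  case (nonneg n)
  then show "f \<in> L \<Longrightarrow> ?thesis" using scale_nat [of f n] by simp
next
  case (nonpos n)
  then show "f \<in> L \<Longrightarrow> ?thesis" using uminus [OF scale_nat [of f n]] by simp
qed

lemma const_int: "(\<lambda>_. of_int k) \<in> L"
  using scale_int [OF one, of k] by simp

lemma clip: "f \<in> L \<Longrightarrow> clip n f \<in> L"
  unfolding clip_def [abs_def] by (intro min one scale_nat max zero)

lemma clip_bounds: "0 \<le> clip n f x" "clip n f x \<le> 1"
  by (auto simp: clip_def)

lemma clip_tendsto: "(\<lambda>n. clip n f x) \<longlonglongrightarrow> indicator {x. 0 < f x} x"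
proof (cases "0 < f x")
  case True
  obtain n0 :: nat where "1 / f x < n0"
    using reals_Archimedean2 by blast
  have "eventually (\<lambda>n. clip n f x = 1) sequentially"
    using eventually_ge_at_top [of n0]
  proof eventually_elim
    case (elim n)
    then have "1 / f x \<le> real n" using \<open>1 / f x < n0\<close> by linarith
    then show ?case using True by (simp add: clip_def field_simps)
  qed
  then show ?thesis using True by (simp add: tendsto_eventually)
qed (simp add: clip_def)

lemma positivity_sets_subset: "positivity_sets \<subseteq> Pow \<Omega>"
  by (auto simp: positivity_sets_def)

lemma positivity_setsI: "f \<in> L \<Longrightarrow> {x \<in> \<Omega>. 0 < f x} \<in> positivity_sets"
  by (auto simp: positivity_sets_def)

lemma Int_stable_positivity_sets: "Int_stable positivity_sets"
proof (rule Int_stableI)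
  fix A B assume "A \<in> positivity_sets" "B \<in> positivity_sets"
  then obtain f g where "f \<in> L" "g \<in> L" "A = {x \<in> \<Omega>. 0 < f x}" "B = {x \<in> \<Omega>. 0 < g x}"
    by (auto simp: positivity_sets_def)
  moreover from this have "A \<inter> B = {x \<in> \<Omega>. 0 < min (f x) (g x)}"
    by auto
  ultimately show "A \<inter> B \<in> positivity_sets"
    using positivity_setsI [OF min] by simp
qed

lemma space_in_positivity_sets: "\<Omega> \<in> positivity_sets"
  using positivity_setsI [OF one] by simp

text \<open>Integer combinations reach rational thresholds only: \<open>a / b < f\<close> means
  \<open>0 < b * f - a\<close> for \<open>b > 0\<close>. Real thresholds follow by a countable
  union.\<close>

lemma measurable:
  assumes f: "f \<in> L" and M: "sets M = sigma_sets \<Omega> positivity_sets"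
  shows "f \<in> borel_measurable M"
proof -
  have sp: "space M = \<Omega>"
    using M positivity_sets_subset sets_eq_imp_space_eq [of M "sigma \<Omega> positivity_sets"]
    by (simp add: space_measure_of)
  have *: "{x \<in> \<Omega>. of_rat q < f x} \<in> sets M" for q
  proof -
    obtain a b where ab: "quotient_of q = (a, b)" by fastforce
    then have b: "b > 0" using quotient_of_denom_pos by blast
    have q: "q = of_int a / of_int b" using ab by (rule quotient_of_div)
    have "(\<lambda>x. of_int b * f x - of_int a) \<in> L"
      by (intro diff scale_int const_int f)
    then have "{x \<in> \<Omega>. 0 < of_int b * f x - of_int a} \<in> positivity_sets"
      by (rule positivity_setsI)
    moreover have "(0 < of_int b * f x - of_int a) = ((of_rat q :: real) < f x)" for x
      using b by (simp add: q of_rat_divide field_simps)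
    ultimately show ?thesis using M by simp
  qed
  show ?thesis
    unfolding borel_measurable_iff_greater sp
  proof
    fix a :: real
    have "{x \<in> \<Omega>. a < f x} = (\<Union>q\<in>{q. a < of_rat q}. {x \<in> \<Omega>. of_rat q < f x})"
      using of_rat_dense by (auto intro: less_trans)
    also have "\<dots> \<in> sets M"
      using * by (intro sets.countable_UN') auto
    finally show "{x \<in> \<Omega>. a < f x} \<in> sets M" .
  qed
qed

lemma integrable:
  assumes f: "f \<in> L" and M: "sets M = sigma_sets \<Omega> positivity_sets" and "finite_measure M"
  shows "integrable M f"
proof -
  interpret finite_measure M by fact
  have sp: "space M = \<Omega>"
    using M positivity_sets_subset sets_eq_imp_space_eq [of M "sigma \<Omega> positivity_sets"]
    by (simp add: space_measure_of)
  obtain B where "\<forall>x\<in>\<Omega>. \<bar>f x\<bar> \<le> B" using bounded [OF f] by blast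
  then show ?thesis
    by (intro integrable_const_bound [of _ B] AE_I2 measurable assms) (auto simp: sp)
qed

text \<open>The inner map \<open>r\<close> and the weight \<open>h\<close> allow a use on a product
  space, with \<open>r\<close> a projection and \<open>h\<close> an indicator in the other variable.
  The case of one measure on \<Omega> has \<open>r\<close> the identity and
  \<open>h = 1\<close>.\<close>

lemma integral_clip_tendsto:
  assumes f: "f \<in> L" and "finite_measure M" and h: "h \<in> borel_measurable M"
    and bnd: "\<And>y. y \<in> space M \<Longrightarrow> \<bar>h y\<bar> \<le> 1"
    and r: "\<And>n. (\<lambda>y. clip n f (r y)) \<in> borel_measurable M"
  shows "(\<lambda>n. \<integral>y. clip n f (r y) * h y \<partial>M) \<longlonglongrightarrow> (\<integral>y. indicator {x. 0 < f x} (r y) * h y \<partial>M)"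
proof -
  interpret finite_measure M by fact
  have lim: "(\<lambda>n. clip n f (r y) * h y) \<longlonglongrightarrow> indicator {x. 0 < f x} (r y) * h y" for y
    by (intro tendsto_mult clip_tendsto tendsto_const)
  show ?thesis
  proof (rule integral_dominated_convergence [where w = "\<lambda>_. 1"])
    show "(\<lambda>y. indicator {x. 0 < f x} (r y) * h y) \<in> borel_measurable M"
      by (rule borel_measurable_LIMSEQ_real [OF lim]) (intro borel_measurable_times r h)
    show "AE y in M. norm (clip n f (r y) * h y) \<le> 1" for n
      using bnd clip_bounds [of n f] by (intro AE_I2) (auto simp: abs_mult intro!: mult_le_one)
  qed (use lim r h in auto)
qed

lemma measure_clip_tendsto:
  assumes f: "f \<in> L" and M: "sets M = sigma_sets \<Omega> positivity_sets" and "finite_measure M"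
  shows "(\<lambda>n. \<integral>x. clip n f x \<partial>M) \<longlonglongrightarrow> measure M {x \<in> \<Omega>. 0 < f x}"
proof -
  interpret finite_measure M by fact
  have sp: "space M = \<Omega>"
    using M positivity_sets_subset sets_eq_imp_space_eq [of M "sigma \<Omega> positivity_sets"]
    by (simp add: space_measure_of)
  have S: "{x \<in> \<Omega>. 0 < f x} \<in> sets M"
    using positivity_setsI [OF f] M by auto
  have "(\<lambda>n. \<integral>x. clip n f x * (1::real) \<partial>M) \<longlonglongrightarrow> (\<integral>x. indicator {x. 0 < f x} x * (1::real) \<partial>M)"
    using f by (intro integral_clip_tendsto measurable [OF clip M] assms) auto
  also have "(\<integral>x. indicator {x. 0 < f x} x * (1::real) \<partial>M) = (\<integral>x. (indicator {x \<in> \<Omega>. 0 < f x} x :: real) \<partial>M)"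
    by (rule Bochner_Integration.integral_cong) (auto simp: sp indicator_def)
  finally show ?thesis using S by simp
qed

text \<open>Integrals of clips converge to the measures of positivity sets, and these sets form a
  pi-system because \<open>L\<close> is closed under minima.\<close>

lemma measure_eqI:
  assumes M: "prob_space M" "sets M = sigma_sets \<Omega> positivity_sets"
    and N: "prob_space N" "sets N = sigma_sets \<Omega> positivity_sets"
    and eq: "\<And>f. f \<in> L \<Longrightarrow> (\<integral>x. f x \<partial>M) = (\<integral>x. f x \<partial>N)"
  shows "M = N"
proof (rule measure_eqI_generator_eq [OF Int_stable_positivity_sets positivity_sets_subset _ M(2) N(2),
      where A = "\<lambda>_. \<Omega>"])
  interpret M: prob_space M by fact
  interpret N: prob_space N by fact
  show "emeasure M X = emeasure N X" if X: "X \<in> positivity_sets" for X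
  proof -
    from X obtain f where f: "f \<in> L" "X = {x \<in> \<Omega>. 0 < f x}" by (auto simp: positivity_sets_def)
    have "measure M X = measure N X"
      using measure_clip_tendsto [OF f(1) M(2) M.finite_measure_axioms]
        measure_clip_tendsto [OF f(1) N(2) N.finite_measure_axioms] eq [OF clip [OF f(1)]]
      by (auto intro: LIMSEQ_unique simp: f(2))
    then show ?thesis by (simp add: M.emeasure_eq_measure N.emeasure_eq_measure)
  qed
  show "emeasure M \<Omega> \<noteq> \<infinity>" by simp
qed (use space_in_positivity_sets in auto)

end

text \<open>Slices \<open>t\<close> at the integers: term \<open>k\<close> is the length of the part
  of \<open>[0, t]\<close> inside \<open>[k, k + 1]\<close>.\<close>

lemma sum_unit_clamps:
  fixes t :: real
  assumes "0 \<le> t"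
  shows "(\<Sum>k<m. max 0 (min 1 (t - real k))) = min t (real m)"
  using assms by (induction m) (auto simp: min_def max_def)

section \<open>Positive functionals and Daniell continuity\<close>

locale positive_functional = function_lattice +
  fixes I :: "('a \<Rightarrow> real) \<Rightarrow> real"
  assumes I_one: "I (\<lambda>_. 1) = 1"
    and I_add: "f \<in> L \<Longrightarrow> g \<in> L \<Longrightarrow> I (\<lambda>x. f x + g x) = I f + I g"
    and I_nonneg: "f \<in> L \<Longrightarrow> (\<And>x. x \<in> \<Omega> \<Longrightarrow> 0 \<le> f x) \<Longrightarrow> 0 \<le> I f"
begin

lemma I_zero: "I (\<lambda>_. 0) = 0"
  using I_add [OF zero zero] by simp

lemma I_uminus: "f \<in> L \<Longrightarrow> I (\<lambda>x. - f x) = - I f"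
  using I_add [OF _ uminus, of f f] I_zero by simp

lemma I_diff: "f \<in> L \<Longrightarrow> g \<in> L \<Longrightarrow> I (\<lambda>x. f x - g x) = I f - I g"
  using I_add [OF _ uminus, of f g] I_uminus by simp

lemma I_mono: "f \<in> L \<Longrightarrow> g \<in> L \<Longrightarrow> (\<And>x. x \<in> \<Omega> \<Longrightarrow> f x \<le> g x) \<Longrightarrow> I f \<le> I g"
  using I_nonneg [OF diff, of g f] I_diff [of g f] by simp

text \<open>Positivity is tested on \<Omega> only, so values of these total functions off \<Omega>
  cannot influence \<open>I\<close>.\<close>

lemma I_cong: "f \<in> L \<Longrightarrow> g \<in> L \<Longrightarrow> (\<And>x. x \<in> \<Omega> \<Longrightarrow> f x = g x) \<Longrightarrow> I f = I g"
  by (rule antisym) (auto intro: I_mono)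

lemma sum_mem:
  fixes F :: "nat \<Rightarrow> 'a \<Rightarrow> real"
  assumes "\<And>k. F k \<in> L"
  shows "(\<lambda>x. \<Sum>k<n. F k x) \<in> L"
  by (induction n) (auto simp: zero intro: add assms)

lemma I_sum:
  fixes F :: "nat \<Rightarrow> 'a \<Rightarrow> real"
  assumes "\<And>k. F k \<in> L"
  shows "I (\<lambda>x. \<Sum>k<n. F k x) = (\<Sum>k<n. I (F k))"
  by (induction n) (auto simp: I_zero I_add assms sum_mem)

lemma I_scale_nat: "f \<in> L \<Longrightarrow> I (\<lambda>x. real n * f x) = real n * I f"
  by (induction n) (auto simp: I_zero I_add scale_nat distrib_right)

lemma I_const_nat: "I (\<lambda>_. real n) = real n"
  using I_scale_nat [OF one, of n] I_one by simp

end

locale daniell_functional = positive_functional +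
  assumes I_continuous: "(\<And>n. F n \<in> L) \<Longrightarrow> (\<And>x. x \<in> \<Omega> \<Longrightarrow> decseq (\<lambda>n. F n x)) \<Longrightarrow>
      (\<And>x. x \<in> \<Omega> \<Longrightarrow> (\<lambda>n. F n x) \<longlonglongrightarrow> 0) \<Longrightarrow> (\<lambda>n. I (F n)) \<longlonglongrightarrow> 0"
begin

text \<open>The remainders \<open>g\<close> minus the partial sums decrease to 0, so Daniell
  continuity applies to them. This becomes countable additivity on strips.\<close>

lemma I_sums:
  fixes F :: "nat \<Rightarrow> 'a \<Rightarrow> real"
  assumes F: "\<And>n. F n \<in> L" and nonneg: "\<And>n x. x \<in> \<Omega> \<Longrightarrow> 0 \<le> F n x"
    and g: "g \<in> L" and sums: "\<And>x. x \<in> \<Omega> \<Longrightarrow> (\<lambda>n. F n x) sums g x"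
  shows "(\<lambda>n. I (F n)) sums I g"
proof -
  have "(\<lambda>n. I (\<lambda>x. g x - (\<Sum>k<n. F k x))) \<longlonglongrightarrow> 0"
  proof (rule I_continuous)
    show "(\<lambda>x. g x - (\<Sum>k<n. F k x)) \<in> L" for n
      by (intro diff g sum_mem F)
    show "decseq (\<lambda>n. g x - (\<Sum>k<n. F k x))" if "x \<in> \<Omega>" for x
      using nonneg [OF that] by (intro decseq_SucI) simp
    show "(\<lambda>n. g x - (\<Sum>k<n. F k x)) \<longlonglongrightarrow> 0" if "x \<in> \<Omega>" for x
      using tendsto_diff [OF tendsto_const [of "g x"] sums [OF that, unfolded sums_def]] by simp
  qed
  then have "(\<lambda>n. I g - (\<Sum>k<n. I (F k))) \<longlonglongrightarrow> 0"
    by (simp add: I_diff I_sum F g sum_mem)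
  then show ?thesis
    unfolding sums_def using tendsto_diff [OF tendsto_const [of "I g"]] by fastforce
qed

text \<open>On the semiring of strips between two functions of \<open>L\<close>, the functional is a premeasure; the
  measure of \<open>A\<close> is then that of the cylinder \<open>A \<times> {0..<1}\<close>.\<close>
definition strip :: "('a \<Rightarrow> real) \<times> ('a \<Rightarrow> real) \<Rightarrow> ('a \<times> real) set" where
  "strip p = {(x, t). x \<in> \<Omega> \<and> fst p x \<le> t \<and> t < snd p x}"

text \<open>The order condition makes \<open>g - f\<close> the length of every section; where the
  bounds were reversed the section would be empty but \<open>g - f\<close> negative.\<close>

definition strip_bounds :: "(('a \<Rightarrow> real) \<times> ('a \<Rightarrow> real)) set" where
  "strip_bounds = {(f, g). f \<in> L \<and> g \<in> L \<and> (\<forall>x\<in>\<Omega>. f x \<le> g x)}"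

definition strip_measure :: "('a \<times> real) measure" where
  "strip_measure = extend_measure (\<Omega> \<times> UNIV) strip_bounds strip
     (\<lambda>p. ennreal (I (\<lambda>x. snd p x - fst p x)))"

lemma strip_subset: "strip ` strip_bounds \<subseteq> Pow (\<Omega> \<times> UNIV)"
  by (auto simp: strip_def)

lemma strip_boundsI: "f \<in> L \<Longrightarrow> g \<in> L \<Longrightarrow> (\<And>x. x \<in> \<Omega> \<Longrightarrow> f x \<le> g x) \<Longrightarrow> (f, g) \<in> strip_bounds"
  by (auto simp: strip_bounds_def)

lemma semiring_strips: "semiring_of_sets (\<Omega> \<times> UNIV) (strip ` strip_bounds)"
proof
  show "strip ` strip_bounds \<subseteq> Pow (\<Omega> \<times> UNIV)"
    by (rule strip_subset)
  have "strip (\<lambda>_. 0, \<lambda>_. 0) = {}"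
    by (auto simp: strip_def)
  then show "{} \<in> strip ` strip_bounds"
    using strip_boundsI [OF zero zero] by (auto intro!: image_eqI [of _ _ "(\<lambda>_. 0, \<lambda>_. 0)"])
next
  fix a b assume "a \<in> strip ` strip_bounds" "b \<in> strip ` strip_bounds"
  then obtain f g f' g' where
    a: "f \<in> L" "g \<in> L" "\<And>x. x \<in> \<Omega> \<Longrightarrow> f x \<le> g x" "a = strip (f, g)" and
    b: "f' \<in> L" "g' \<in> L" "\<And>x. x \<in> \<Omega> \<Longrightarrow> f' x \<le> g' x" "b = strip (f', g')"
    by (auto simp: strip_bounds_def)
  let ?lo = "\<lambda>x. max (f x) (f' x)"
  \<comment> \<open>Where the two intervals miss each other, the outer \<open>max\<close> makes the
    section empty instead of reversing its ends.\<close>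
  let ?hi = "\<lambda>x. max (?lo x) (min (g x) (g' x))"
  have "a \<inter> b = strip (?lo, ?hi)"
    unfolding a(4) b(4) strip_def by auto
  moreover have "(?lo, ?hi) \<in> strip_bounds"
    by (intro strip_boundsI max min a b) auto
  ultimately show "a \<inter> b \<in> strip ` strip_bounds" by blast
  \<comment> \<open>Taking \<open>[f', g')\<close> out of \<open>[f, g)\<close> leaves a part below
    \<open>f'\<close> and a part from \<open>g'\<close> on. The clamping to \<open>[f, g]\<close>
    again keeps the bounds in order.\<close>
  let ?p = "(f, \<lambda>x. max (f x) (min (g x) (f' x)))"
  let ?q = "(\<lambda>x. min (g x) (max (f x) (g' x)), g)"
  have "?p \<in> strip_bounds" "?q \<in> strip_bounds"
    by (intro strip_boundsI max min a b; auto)+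
  moreover have "a - b = strip ?p \<union> strip ?q" "strip ?p \<inter> strip ?q = {}"
    using a(3) b(3) unfolding a(4) b(4) strip_def
    by (auto simp: less_max_iff_disj min_le_iff_disj not_le not_less) (meson b(3) leD less_le_trans)
  ultimately show "\<exists>C\<subseteq>strip ` strip_bounds. finite C \<and> disjoint C \<and> a - b = \<Union>C"
    by (intro exI [of _ "{strip ?p, strip ?q}"]) (auto simp: disjoint_def)
qed

lemma strip_section: "x \<in> \<Omega> \<Longrightarrow> Pair x -` strip (f, g) = {f x..<g x}"
  by (auto simp: strip_def)

text \<open>Over each point of \<Omega> the sections of disjoint strips are disjoint half-open
  intervals, whose lengths add up by Lebesgue measure. Applying \<open>I_sums\<close> to this
  pointwise series gives the countable additivity for Caratheodory's extension.\<close>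

lemma emeasure_strip:
  assumes p: "(f, g) \<in> strip_bounds"
  shows "emeasure strip_measure (strip (f, g)) = ennreal (I (\<lambda>x. g x - f x))"
proof -
  let ?\<mu> = "\<lambda>p. ennreal (I (\<lambda>x. snd p x - fst p x))"
  \<comment> \<open>A strip does not determine its pair of bounds: they may differ off \<Omega>, and
    an empty section arises from many endpoints. It does determine the length of each section, hence
    the value of \<open>I\<close>.\<close>
  have I_eq: "?\<mu> (f, g) = ?\<mu> (f', g')"
    if "(f, g) \<in> strip_bounds" "(f', g') \<in> strip_bounds" "strip (f, g) = strip (f', g')" for f g f' g'
  proof -
    have "I (\<lambda>x. g x - f x) = I (\<lambda>x. g' x - f' x)"
    proof (rule I_cong)
      fix x assume x: "x \<in> \<Omega>"
      then have "{f x..<g x} = {f' x..<g' x}"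
        using that(3) by (simp flip: strip_section)
      then have "measure lborel {f x..<g x} = measure lborel {f' x..<g' x}"
        by (rule arg_cong)
      moreover have "f x \<le> g x" "f' x \<le> g' x"
        using that(1,2) x by (auto simp: strip_bounds_def)
      ultimately show "g x - f x = g' x - f' x"
        by simp
    qed (use that in \<open>auto simp: strip_bounds_def intro: diff\<close>)
    then show ?thesis by simp
  qed
  have "emeasure strip_measure (strip (f, g)) = ?\<mu> (f, g)"
  proof (rule extend_measure_caratheodory [OF strip_measure_def p semiring_strips])
    show "?\<mu> i = 0" if i: "i \<in> strip_bounds" "strip i = {}" for i
    proof -
      have "strip (\<lambda>_. 0, \<lambda>_. 0) = {}"
        by (auto simp: strip_def)
      then show ?thesis
        using I_eq [of "fst i" "snd i" "\<lambda>_. 0" "\<lambda>_. 0"] i strip_boundsI [OF zero zero] by (simp add: I_zero)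
    qed
    show "?\<mu> i = ?\<mu> j" if "i \<in> strip_bounds" "j \<in> strip_bounds" "strip i = strip j" for i j
      using I_eq [of "fst i" "snd i" "fst j" "snd j"] that by simp
    show "(\<Sum>n. ?\<mu> (A n)) = ?\<mu> j"
      if A: "A \<in> UNIV \<rightarrow> strip_bounds" and j: "j \<in> strip_bounds"
        and disj: "disjoint_family (strip \<circ> A)" and un: "(\<Union>i. strip (A i)) = strip j"
      for A :: "nat \<Rightarrow> ('a \<Rightarrow> real) \<times> ('a \<Rightarrow> real)" and j
    proof -
      have A': "fst (A n) \<in> L" "snd (A n) \<in> L" "\<And>x. x \<in> \<Omega> \<Longrightarrow> fst (A n) x \<le> snd (A n) x" for n
        using funcset_mem [OF A, of n] by (auto simp: strip_bounds_def)
      have j': "fst j \<in> L" "snd j \<in> L" "\<And>x. x \<in> \<Omega> \<Longrightarrow> fst j x \<le> snd j x"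
        using j by (auto simp: strip_bounds_def)
      have "(\<lambda>n. I (\<lambda>x. snd (A n) x - fst (A n) x)) sums I (\<lambda>x. snd j x - fst j x)"
      proof (rule I_sums)
        fix x assume x: "x \<in> \<Omega>"
        have sec: "Pair x -` strip (A n) = {fst (A n) x..<snd (A n) x}" for n
          using strip_section [OF x, of "fst (A n)" "snd (A n)"] by simp
        have secj: "Pair x -` strip j = {fst j x..<snd j x}"
          using strip_section [OF x, of "fst j" "snd j"] by simp
        have "disjoint_family (\<lambda>n. {fst (A n) x..<snd (A n) x})"
          using disj unfolding disjoint_family_on_def sec [symmetric] by fastforce
        moreover have "(\<Union>n. {fst (A n) x..<snd (A n) x}) = {fst j x..<snd j x}"
          unfolding sec [symmetric] secj [symmetric] un [symmetric] by auto
        ultimately have "(\<lambda>n. emeasure lborel {fst (A n) x..<snd (A n) x}) sums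
            emeasure lborel {fst j x..<snd j x}"
          using sums_emeasure [of "\<lambda>n. {fst (A n) x..<snd (A n) x}" lborel] by auto
        then show "(\<lambda>n. snd (A n) x - fst (A n) x) sums (snd j x - fst j x)"
          using A'(3) [OF x] j'(3) [OF x] by simp
      qed (use A' j' in \<open>auto intro: diff\<close>)
      then show ?thesis
        using A' j' by (intro sums_unique [symmetric]) (subst sums_ennreal, auto intro!: I_nonneg diff)
    qed
  qed auto
  then show ?thesis by simp
qed

lemma sets_strip_measure: "sets strip_measure = sigma_sets (\<Omega> \<times> UNIV) (strip ` strip_bounds)"
  unfolding strip_measure_def using strip_subset by (rule sets_extend_measure)

lemma space_strip_measure: "space strip_measure = \<Omega> \<times> UNIV"
  unfolding strip_measure_def using strip_subset by (rule space_extend_measure)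

lemma strip_in_sets: "f \<in> L \<Longrightarrow> g \<in> L \<Longrightarrow> (\<And>x. x \<in> \<Omega> \<Longrightarrow> f x \<le> g x) \<Longrightarrow> strip (f, g) \<in> sets strip_measure"
  unfolding sets_strip_measure by (auto intro: strip_boundsI)

lemma unit_strip: "\<Omega> \<times> {0..<1} = strip (\<lambda>_. 0, \<lambda>_. 1)"
  by (auto simp: strip_def)

lemma unit_strip_in_sets: "\<Omega> \<times> {0..<1} \<in> sets strip_measure"
  unfolding unit_strip by (intro strip_in_sets zero one) auto

lemma emeasure_unit_strip: "emeasure strip_measure (\<Omega> \<times> {0..<1}) = 1"
  unfolding unit_strip using emeasure_strip [OF strip_boundsI [OF zero one]] by (simp add: I_one)

lemma cylinder_in_sets:
  assumes "A \<in> sigma_sets \<Omega> positivity_sets"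
  shows "A \<times> {0..<1} \<in> sets strip_measure"
  using assms
proof induction
  case (Basic A)
  then obtain f where f: "f \<in> L" "A = {x \<in> \<Omega>. 0 < f x}" by (auto simp: positivity_sets_def)
  \<comment> \<open>A height \<open>t < 1\<close> is exceeded by \<open>clip n f x\<close> for large
    \<open>n\<close> when \<open>0 < f x\<close>; the heights are half-open at 1 because
    \<open>clip\<close> never exceeds 1.\<close>
  have "A \<times> {0..<1} = (\<Union>n. strip (\<lambda>_. 0, clip n f))"
  proof safe
    fix x and t :: real assume "x \<in> A" "t \<in> {0..<1}"
    moreover from this have "(\<lambda>n. clip n f x) \<longlonglongrightarrow> 1"
      using clip_tendsto [of f x] f by simp
    ultimately have "eventually (\<lambda>n. t < clip n f x) sequentially"
      by (intro order_tendstoD) auto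
    then obtain n where "t < clip n f x"
      by (auto simp: eventually_sequentially)
    then show "(x, t) \<in> (\<Union>n. strip (\<lambda>_. 0, clip n f))"
      using \<open>x \<in> A\<close> \<open>t \<in> {0..<1}\<close> f by (auto simp: strip_def)
  next
    fix x t n assume *: "(x, t) \<in> strip (\<lambda>_. 0, clip n f)"
    then have "0 < clip n f x" by (auto simp: strip_def)
    then have "0 < f x" by (rule contrapos_pp) (simp add: clip_def)
    then show "x \<in> A" using * f by (auto simp: strip_def)
    show "t \<in> {0..<1}" using * clip_bounds(2) [of n f x] by (auto simp: strip_def)
  qed
  also have "\<dots> \<in> sets strip_measure"
    by (intro sets.countable_UN image_subsetI strip_in_sets zero clip f clip_bounds)
  finally show ?case .
next
  case (Compl A)
  have "(\<Omega> - A) \<times> {0..<1} = (\<Omega> \<times> {0..<1}) - (A \<times> {0..<1::real})" by auto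
  then show ?case using Compl unit_strip_in_sets by simp
next
  case (Union A)
  have "(\<Union>i. A i) \<times> {0..<1::real} = (\<Union>i. A i \<times> {0..<1})" by auto
  then show ?case using Union by auto
qed simp

text \<open>On a nonempty \<Omega> the strips extend over all heights and have infinite total mass;
  the layer between 0 and 1 has mass \<open>I (\<lambda>_. 1) = 1\<close>, so projecting it gives a
  probability measure.\<close>

definition daniell_measure :: "'a measure" where
  "daniell_measure =
     distr (restrict_space strip_measure (\<Omega> \<times> {0..<1})) (sigma \<Omega> positivity_sets) fst"

lemma sets_daniell_measure: "sets daniell_measure = sigma_sets \<Omega> positivity_sets"
  unfolding daniell_measure_def using positivity_sets_subset by (simp add: sets_measure_of)

lemma space_daniell_measure: "space daniell_measure = \<Omega>"
  unfolding daniell_measure_def using positivity_sets_subset by (simp add: space_measure_of)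

lemma emeasure_daniell_measure:
  assumes A: "A \<in> sigma_sets \<Omega> positivity_sets"
  shows "emeasure daniell_measure A = emeasure strip_measure (A \<times> {0..<1})"
proof -
  let ?R = "restrict_space strip_measure (\<Omega> \<times> {0..<1})"
  have spR: "space ?R = \<Omega> \<times> {0..<1}"
    by (auto simp: space_restrict_space space_strip_measure)
  have vim: "fst -` A \<inter> space ?R = A \<times> {0..<1}" if "A \<in> sigma_sets \<Omega> positivity_sets" for A
    using sigma_sets_into_sp [OF positivity_sets_subset that] by (auto simp: spR)
  have "fst \<in> ?R \<rightarrow>\<^sub>M sigma \<Omega> positivity_sets"
  proof (rule measurableI)
    fix B assume "B \<in> sets (sigma \<Omega> positivity_sets)"
    then have B: "B \<in> sigma_sets \<Omega> positivity_sets"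
      using positivity_sets_subset by (simp add: sets_measure_of)
    have "B \<times> {0..<1} = (B \<times> {0..<1}) \<inter> (\<Omega> \<times> {0..<1::real})"
      using sigma_sets_into_sp [OF positivity_sets_subset B] by auto
    then show "fst -` B \<inter> space ?R \<in> sets ?R"
      unfolding vim [OF B] using cylinder_in_sets [OF B] by (auto simp: sets_restrict_space)
  qed (use positivity_sets_subset in \<open>auto simp: spR space_measure_of\<close>)
  then have "emeasure daniell_measure A = emeasure ?R (fst -` A \<inter> space ?R)"
    unfolding daniell_measure_def using A positivity_sets_subset by (simp add: emeasure_distr sets_measure_of)
  also have "\<dots> = emeasure ?R (A \<times> {0..<1})"
    by (simp add: vim [OF A])
  also have "\<dots> = emeasure strip_measure (A \<times> {0..<1})"
    using sigma_sets_into_sp [OF positivity_sets_subset A] unit_strip_in_sets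
    by (intro emeasure_restrict_space) (auto simp flip: space_strip_measure)
  finally show ?thesis .
qed

lemma prob_space_daniell_measure: "prob_space daniell_measure"
proof
  show "emeasure daniell_measure (space daniell_measure) = 1"
    unfolding space_daniell_measure
    by (subst emeasure_daniell_measure) (auto simp: emeasure_unit_strip sigma_sets_top)
qed

section \<open>Comparison of the functional with the integral\<close>

lemma superlevel_in_sets:
  assumes "f \<in> L"
  shows "{x \<in> \<Omega>. r < f x} \<in> sets daniell_measure" "{x \<in> \<Omega>. r \<le> f x} \<in> sets daniell_measure"
  using measurable [OF assms sets_daniell_measure]
    measurable [OF assms sets_daniell_measure, unfolded borel_measurable_iff_greater]
    measurable [OF assms sets_daniell_measure, unfolded borel_measurable_iff_ge]
  by (simp_all add: space_daniell_measure)

text \<open>The strip below \<open>h\<close>, of mass \<open>I h\<close>, contains the unit cylinder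
  over \<open>{1 \<le> h}\<close> and lies in the one over \<open>{0 < h}\<close>.\<close>

lemma daniell_measure_sandwich:
  assumes h: "h \<in> L" "\<And>x. x \<in> \<Omega> \<Longrightarrow> 0 \<le> h x" "\<And>x. x \<in> \<Omega> \<Longrightarrow> h x \<le> 1"
  shows "measure daniell_measure {x \<in> \<Omega>. 1 \<le> h x} \<le> I h"
    and "I h \<le> measure daniell_measure {x \<in> \<Omega>. 0 < h x}"
proof -
  interpret prob_space daniell_measure by (rule prob_space_daniell_measure)
  have S: "{x \<in> \<Omega>. 1 \<le> h x} \<in> sets daniell_measure" "{x \<in> \<Omega>. 0 < h x} \<in> sets daniell_measure"
    by (intro superlevel_in_sets h)+
  have nn: "0 \<le> I h" using h by (intro I_nonneg) auto
  have hs: "strip (\<lambda>_. 0, h) \<in> sets strip_measure"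
    by (intro strip_in_sets zero h)
  have Ih: "ennreal (I h) = emeasure strip_measure (strip (\<lambda>_. 0, h))"
    using emeasure_strip [OF strip_boundsI [OF zero h(1,2)]] by simp
  have "emeasure daniell_measure {x \<in> \<Omega>. 1 \<le> h x} \<le> ennreal (I h)"
    using S(1) unfolding sets_daniell_measure Ih
    by (subst emeasure_daniell_measure)
      (assumption, intro emeasure_mono hs, auto simp: strip_def intro: less_le_trans)
  then show "measure daniell_measure {x \<in> \<Omega>. 1 \<le> h x} \<le> I h"
    using nn by (simp add: emeasure_eq_measure)
  have "ennreal (I h) \<le> emeasure daniell_measure {x \<in> \<Omega>. 0 < h x}"
    using S(2) h(2,3) unfolding sets_daniell_measure Ih
    by (subst emeasure_daniell_measure)
      (auto intro!: emeasure_mono [OF _ cylinder_in_sets] simp: strip_def intro: le_less_trans less_le_trans [OF _ h(3)])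
  then show "I h \<le> measure daniell_measure {x \<in> \<Omega>. 0 < h x}"
    by (simp add: emeasure_eq_measure)
qed

text \<open>These are the bounds already found for \<open>I h\<close>, so \<open>I h\<close> and the
  integral differ by at most the measure of \<open>{0 < h}\<close> minus that of
  \<open>{1 \<le> h}\<close>.\<close>

lemma integral_sandwich:
  assumes h: "h \<in> L" "\<And>x. x \<in> \<Omega> \<Longrightarrow> 0 \<le> h x" "\<And>x. x \<in> \<Omega> \<Longrightarrow> h x \<le> 1"
  shows "measure daniell_measure {x \<in> \<Omega>. 1 \<le> h x} \<le> (\<integral>x. h x \<partial>daniell_measure)"
    and "(\<integral>x. h x \<partial>daniell_measure) \<le> measure daniell_measure {x \<in> \<Omega>. 0 < h x}"
proof -
  interpret prob_space daniell_measure by (rule prob_space_daniell_measure)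
  have int: "integrable daniell_measure h"
    using h(1) sets_daniell_measure finite_measure_axioms by (rule integrable)
  have S: "{x \<in> \<Omega>. 1 \<le> h x} \<in> sets daniell_measure" "{x \<in> \<Omega>. 0 < h x} \<in> sets daniell_measure"
    by (intro superlevel_in_sets h)+
  have "(\<integral>x. indicator {x \<in> \<Omega>. 1 \<le> h x} x \<partial>daniell_measure) \<le> (\<integral>x. h x \<partial>daniell_measure)"
    using h int S(1)
    by (intro integral_mono integrable_real_indicator) (auto simp: space_daniell_measure emeasure_eq_measure split: split_indicator)
  then show "measure daniell_measure {x \<in> \<Omega>. 1 \<le> h x} \<le> (\<integral>x. h x \<partial>daniell_measure)"
    using S(1) by simp
  have "(\<integral>x. h x \<partial>daniell_measure) \<le> (\<integral>x. indicator {x \<in> \<Omega>. 0 < h x} x \<partial>daniell_measure)"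
    using h int S(2)
    by (intro integral_mono integrable_real_indicator) (auto simp: space_daniell_measure emeasure_eq_measure not_less split: split_indicator)
  then show "(\<integral>x. h x \<partial>daniell_measure) \<le> measure daniell_measure {x \<in> \<Omega>. 0 < h x}"
    using S(2) by simp
qed

text \<open>Cut \<open>n f\<close> into layers of height 1; on each layer both functionals lie between the measures
  of two consecutive superlevel sets, so the errors telescope to at most 1.\<close>
lemma integral_daniell_measure_nonneg:
  assumes f: "f \<in> L" "\<And>x. x \<in> \<Omega> \<Longrightarrow> 0 \<le> f x"
  shows "(\<integral>x. f x \<partial>daniell_measure) = I f"
proof -
  interpret prob_space daniell_measure by (rule prob_space_daniell_measure)
  let ?D = daniell_measure
  obtain B where "\<And>x. x \<in> \<Omega> \<Longrightarrow> \<bar>f x\<bar> \<le> B"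
    using bounded [OF f(1)] by blast
  then have B: "\<And>x. x \<in> \<Omega> \<Longrightarrow> f x \<le> B"
    by (rule abs_le_D1)
  have int: "integrable ?D h" if "h \<in> L" for h
    using that sets_daniell_measure finite_measure_axioms by (rule integrable)
  have "real n * \<bar>I f - (\<integral>x. f x \<partial>?D)\<bar> \<le> 1" for n
  proof -
    obtain m :: nat where m: "real n * B \<le> real m"
      using real_arch_simple by blast
    \<comment> \<open>The part of \<open>n f\<close> between heights \<open>k\<close> and
      \<open>k + 1\<close>; since \<open>n f \<le> m\<close>, the first \<open>m\<close> of these
      layers add up to \<open>n f\<close>.\<close>
    define c where "c k x = max 0 (min 1 (real n * f x - real k))" for k x
    have cL: "c k \<in> L" for k
      unfolding c_def using const_int [of "int k"] by (intro max zero min one diff scale_nat f) simp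
    have c01: "0 \<le> c k x" "c k x \<le> 1" for k x
      by (auto simp: c_def)
    define a where "a k = measure ?D {x \<in> \<Omega>. real k < real n * f x}" for k
    have S: "{x \<in> \<Omega>. r < real n * f x} \<in> sets ?D" "{x \<in> \<Omega>. r \<le> real n * f x} \<in> sets ?D" for r
      by (intro superlevel_in_sets scale_nat f)+
    have up: "{x \<in> \<Omega>. 0 < c k x} = {x \<in> \<Omega>. real k < real n * f x}" for k
      by (auto simp: c_def)
    have lo: "{x \<in> \<Omega>. 1 \<le> c k x} = {x \<in> \<Omega>. real (Suc k) \<le> real n * f x}" for k
      by (auto simp: c_def)
    \<comment> \<open>A full layer means \<open>k + 1 \<le> n f\<close>, while \<open>a\<close> uses
      strict inequalities. The inclusion goes in the direction that bounds the error of layer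
      \<open>k\<close> by \<open>a k - a (Suc k)\<close>.\<close>
    have "a (Suc k) \<le> measure ?D {x \<in> \<Omega>. 1 \<le> c k x}" for k
      unfolding a_def lo using S by (intro finite_measure_mono) auto
    moreover have "measure ?D {x \<in> \<Omega>. 0 < c k x} = a k" for k
      unfolding a_def up ..
    ultimately have each: "\<bar>I (c k) - (\<integral>x. c k x \<partial>?D)\<bar> \<le> a k - a (Suc k)" for k
      using daniell_measure_sandwich [OF cL c01, of k] integral_sandwich [OF cL c01, of k]
      unfolding abs_le_iff by (metis (no_types, lifting) diff_mono minus_diff_eq order_trans)
    have nf: "real n * f x = (\<Sum>k<m. c k x)" if "x \<in> \<Omega>" for x
    proof -
      have "real n * f x \<le> real m"
        using mult_left_mono [OF B [OF that], of "real n"] m by simp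
      then show ?thesis
        unfolding c_def using f(2) [OF that] by (subst sum_unit_clamps) auto
    qed
    have "real n * I f = (\<Sum>k<m. I (c k))"
      using I_cong [OF scale_nat [OF f(1)] sum_mem [OF cL] nf] f(1) cL by (simp add: I_scale_nat I_sum)
    moreover have "real n * (\<integral>x. f x \<partial>?D) = (\<Sum>k<m. \<integral>x. c k x \<partial>?D)"
    proof -
      have "real n * (\<integral>x. f x \<partial>?D) = (\<integral>x. (\<Sum>k<m. c k x) \<partial>?D)"
        using nf by (subst integral_mult_right_zero [symmetric])
          (intro Bochner_Integration.integral_cong, auto simp: space_daniell_measure)
      then show ?thesis by (simp add: int cL)
    qed
    moreover have "real n * \<bar>I f - (\<integral>x. f x \<partial>?D)\<bar> = \<bar>real n * I f - real n * (\<integral>x. f x \<partial>?D)\<bar>"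
      by (simp add: abs_mult flip: right_diff_distrib)
    ultimately have "real n * \<bar>I f - (\<integral>x. f x \<partial>?D)\<bar> = \<bar>\<Sum>k<m. (I (c k) - (\<integral>x. c k x \<partial>?D))\<bar>"
      by (simp add: sum_subtractf)
    also have "\<dots> \<le> (\<Sum>k<m. a k - a (Suc k))"
      by (intro order_trans [OF sum_abs] sum_mono each)
    also have "\<dots> = a 0 - a m"
      by (rule sum_lessThan_telescope')
    also have "\<dots> \<le> 1"
      using prob_le_1 [of "{x \<in> \<Omega>. real 0 < real n * f x}"] measure_nonneg [of ?D "{x \<in> \<Omega>. real m < real n * f x}"]
      unfolding a_def by linarith
    finally show ?thesis .
  qed
  \<comment> \<open>The bound 1 is the same for every \<open>n\<close>, so the error of
    \<open>f\<close> itself is at most \<open>1 / n\<close>.\<close>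
  then have "\<bar>I f - (\<integral>x. f x \<partial>?D)\<bar> = 0"
    using real_archimedian_rdiv_eq_0 [of "\<bar>I f - (\<integral>x. f x \<partial>?D)\<bar>" 1] by (simp add: mult.commute)
  then show ?thesis by simp
qed

theorem integral_daniell_measure:
  assumes f: "f \<in> L"
  shows "(\<integral>x. f x \<partial>daniell_measure) = I f"
proof -
  interpret prob_space daniell_measure by (rule prob_space_daniell_measure)
  obtain B where B: "\<And>x. x \<in> \<Omega> \<Longrightarrow> \<bar>f x\<bar> \<le> B"
    using bounded [OF f] by blast
  obtain m :: nat where m: "B \<le> real m"
    using real_arch_simple by blast
  have cL: "(\<lambda>_. real m) \<in> L"
    using const_int [of "int m"] by simp
  have "(\<integral>x. f x + real m \<partial>daniell_measure) = I (\<lambda>x. f x + real m)"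
    using B m by (intro integral_daniell_measure_nonneg add f cL) fastforce
  moreover have "integrable daniell_measure f"
    using f sets_daniell_measure finite_measure_axioms by (rule integrable)
  ultimately show ?thesis
    using prob_space by (simp add: I_add f cL I_const_nat)
qed

end

section \<open>Compactness in the weak topology\<close>

definition bounded_continuous :: "'a topology \<Rightarrow> ('a \<Rightarrow> real) set" where
  "bounded_continuous X = {f. continuous_map X euclideanreal f \<and> bounded (f ` topspace X)}"

lemma bounded_continuousI:
  "continuous_map X euclideanreal f \<Longrightarrow> (\<And>x. x \<in> topspace X \<Longrightarrow> \<bar>f x\<bar> \<le> B) \<Longrightarrow> f \<in> bounded_continuous X"
  unfolding bounded_continuous_def bounded_iff by auto

lemma bounded_continuousE:
  assumes "f \<in> bounded_continuous X"
  obtains B where "continuous_map X euclideanreal f" "\<And>x. x \<in> topspace X \<Longrightarrow> \<bar>f x\<bar> \<le> B"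
proof -
  have "continuous_map X euclideanreal f" "bounded (f ` topspace X)"
    using assms by (auto simp: bounded_continuous_def)
  moreover from this(2) obtain B where "\<forall>y\<in>f ` topspace X. norm y \<le> B"
    unfolding bounded_iff by blast
  ultimately show thesis by (intro that [of B]) auto
qed

lemma bounded_continuous_compact_space:
  assumes "compact_space X" "continuous_map X euclideanreal f"
  shows "f \<in> bounded_continuous X"
  using assms image_compactin [of X "topspace X" euclideanreal f] compact_imp_bounded
  unfolding bounded_continuous_def by (auto simp: compact_space_def)

interpretation bc: function_lattice "topspace X" "bounded_continuous X" for X :: "'a topology"
proof
  fix f g :: "'a \<Rightarrow> real" assume f: "f \<in> bounded_continuous X" and g: "g \<in> bounded_continuous X"
  from f obtain B where B: "continuous_map X euclideanreal f" "\<And>x. x \<in> topspace X \<Longrightarrow> \<bar>f x\<bar> \<le> B"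
    by (rule bounded_continuousE) blast
  from g obtain C where C: "continuous_map X euclideanreal g" "\<And>x. x \<in> topspace X \<Longrightarrow> \<bar>g x\<bar> \<le> C"
    by (rule bounded_continuousE) blast
  show "(\<lambda>x. f x + g x) \<in> bounded_continuous X"
    using B C by (intro bounded_continuousI [where B = "B + C"] continuous_map_add) fastforce+
  show "(\<lambda>x. max (f x) (g x)) \<in> bounded_continuous X"
    using B C by (intro bounded_continuousI [where B = "max B C"] continuous_map_real_max) fastforce+
next
  fix f :: "'a \<Rightarrow> real" assume "f \<in> bounded_continuous X"
  then obtain B where B: "continuous_map X euclideanreal f" "\<And>x. x \<in> topspace X \<Longrightarrow> \<bar>f x\<bar> \<le> B"
    by (rule bounded_continuousE) blast
  show "(\<lambda>x. - f x) \<in> bounded_continuous X"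
    using B by (intro bounded_continuousI [where B = B] continuous_map_minus) auto
  show "\<exists>B. \<forall>x\<in>topspace X. \<bar>f x\<bar> \<le> B" using B by blast
qed (auto intro: bounded_continuousI [where B = 1])

text \<open>Baire and Borel sets coincide, as on every metrizable space. This puts the measures from
  Daniell's theorem into \<open>borel_prob X\<close> and lets integrals of continuous functions
  determine Borel probability measures.\<close>

definition generated_by_continuous :: "'a topology \<Rightarrow> bool" where
  "generated_by_continuous X \<longleftrightarrow> sets (borel_of X) = sigma_sets (topspace X) (bc.positivity_sets X)"

section \<open>Integrals and the weak topology\<close>

lemma continuous_map_integral:
  assumes "f \<in> bounded_continuous X"
  shows "continuous_map (weak_topology X) euclideanreal (\<lambda>M. \<integral>x. f x \<partial>M)"
  unfolding continuous_map
proof (intro conjI allI impI)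
  fix G :: "real set" assume "openin euclideanreal G"
  with assms show "openin (weak_topology X) {M \<in> topspace (weak_topology X). (\<integral>x. f x \<partial>M) \<in> G}"
    unfolding topspace_weak_topology unfolding weak_topology_def
    by (intro topology_generated_by_Basis) (auto simp: bounded_continuous_def)
qed auto

text \<open>The universal property of the initial topology for the integration maps.\<close>

lemma continuous_map_into_weak_topology:
  assumes g: "\<And>x. x \<in> topspace T \<Longrightarrow> g x \<in> borel_prob X"
    and cont: "\<And>f. f \<in> bounded_continuous X \<Longrightarrow> continuous_map T euclideanreal (\<lambda>x. \<integral>y. f y \<partial>g x)"
  shows "continuous_map T (weak_topology X) g"
  unfolding weak_topology_def continuous_on_generated_topo_iff
proof (intro conjI allI impI)
  fix S assume "S \<in> {{M \<in> borel_prob X. (\<integral>x. f x \<partial>M) \<in> G} | f G.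
     continuous_map X euclideanreal f \<and> bounded (f ` topspace X) \<and> open G}"
  then obtain f G where S: "S = {M \<in> borel_prob X. (\<integral>x. f x \<partial>M) \<in> G}"
    and f: "f \<in> bounded_continuous X" and G: "open G"
    by (auto simp: bounded_continuous_def)
  have "g -` S \<inter> topspace T = {x \<in> topspace T. (\<integral>y. f y \<partial>g x) \<in> G}"
    using g by (auto simp: S)
  also have "openin T \<dots>"
    using cont [OF f] G by (intro openin_continuous_map_preimage) auto
  finally show "openin T (g -` S \<inter> topspace T)" .
next
  have "g ` topspace T \<subseteq> topspace (weak_topology X)"
    using g by auto
  then show "g ` topspace T \<subseteq> \<Union> {{M \<in> borel_prob X. (\<integral>x. f x \<partial>M) \<in> G} | f G.
     continuous_map X euclideanreal f \<and> bounded (f ` topspace X) \<and> open G}"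
    unfolding weak_topology_def topology_generated_by_topspace .
qed

lemma borel_probD:
  assumes "M \<in> borel_prob X"
  shows "prob_space M" "sets M = sets (borel_of X)" "space M = topspace X"
  using assms sets_eq_imp_space_eq [of M "borel_of X"] by (auto simp: borel_prob_def)

lemma continuous_map_measurable:
  assumes "continuous_map X euclideanreal f"
  shows "f \<in> borel_measurable (borel_of X)"
proof (rule borel_measurableI)
  fix S :: "real set" assume "open S"
  then have "openin X {x \<in> topspace X. f x \<in> S}"
    using assms by (intro openin_continuous_map_preimage) auto
  moreover have "f -` S \<inter> space (borel_of X) = {x \<in> topspace X. f x \<in> S}" by auto
  ultimately show "f -` S \<inter> space (borel_of X) \<in> sets (borel_of X)"
    by (auto simp: sets_borel_of)
qed

lemma bounded_continuous_integrable:
  assumes f: "f \<in> bounded_continuous X" and M: "M \<in> borel_prob X"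
  shows "integrable M f"
proof -
  interpret prob_space M using M by (rule borel_probD)
  obtain B where B: "continuous_map X euclideanreal f" "\<And>x. x \<in> topspace X \<Longrightarrow> \<bar>f x\<bar> \<le> B"
    using f by (rule bounded_continuousE) blast
  have "f \<in> borel_measurable M"
    using continuous_map_measurable [OF B(1)] unfolding measurable_cong_sets [OF borel_probD(2) [OF M] refl] .
  then show ?thesis
    using B(2) by (intro integrable_const_bound [of _ B] AE_I2) (auto simp: borel_probD [OF M])
qed

lemma borel_prob_eqI:
  assumes "generated_by_continuous X" "M \<in> borel_prob X" "N \<in> borel_prob X"
    and "\<And>f. f \<in> bounded_continuous X \<Longrightarrow> (\<integral>x. f x \<partial>M) = (\<integral>x. f x \<partial>N)"
  shows "M = N"
  using assms borel_probD [of M X] borel_probD [of N X]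
  by (intro bc.measure_eqI [of M X N]) (auto simp: generated_by_continuous_def)

lemma dini:
  fixes F :: "nat \<Rightarrow> 'a \<Rightarrow> real"
  assumes X: "compact_space X" and F: "\<And>n. continuous_map X euclideanreal (F n)"
    and dec: "\<And>x. x \<in> topspace X \<Longrightarrow> decseq (\<lambda>n. F n x)"
    and lim: "\<And>x. x \<in> topspace X \<Longrightarrow> (\<lambda>n. F n x) \<longlonglongrightarrow> 0" and "0 < e"
  shows "\<exists>n. \<forall>x\<in>topspace X. F n x < e"
proof -
  define V where "V n = {x \<in> topspace X. F n x < e}" for n
  have "openin X (V n)" for n
    using openin_continuous_map_preimage [OF F, of "{..<e}" n] by (simp add: V_def)
  moreover have "topspace X \<subseteq> \<Union>(range V)"
  proof
    fix x assume x: "x \<in> topspace X"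
    then have "eventually (\<lambda>n. F n x < e) sequentially"
      using lim \<open>0 < e\<close> by (intro order_tendstoD) auto
    then show "x \<in> \<Union>(range V)" using x by (auto simp: V_def eventually_sequentially)
  qed
  ultimately obtain \<F> where \<F>: "finite \<F>" "\<F> \<subseteq> range V" "topspace X \<subseteq> \<Union>\<F>"
    using compact_space_alt [THEN iffD1, OF X, rule_format, of "range V"] by blast
  obtain J where J: "finite J" "\<F> = V ` J"
    using finite_subset_image [OF \<F>(1,2)] by blast
  \<comment> \<open>The sets \<open>V n\<close> increase with \<open>n\<close>, so the largest index
    of the finite subcover serves all points. The inserted 0 covers an empty \<open>J\<close>,
    possible when the space is empty.\<close>
  have "F (Max (insert 0 J)) x < e" if x: "x \<in> topspace X" for x
  proof -
    obtain n where n: "n \<in> J" "F n x < e"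
      using \<F>(3) J x by (auto simp: V_def)
    then have "F (Max (insert 0 J)) x \<le> F n x"
      using J by (intro decseqD [OF dec [OF x]]) auto
    then show ?thesis using n by simp
  qed
  then show ?thesis by blast
qed

text \<open>Dini makes the sequence uniformly small and \<open>I (\<lambda>_. 1) = 1\<close> turns
  this into a bound on \<open>I\<close>. Only natural factors pass through \<open>I\<close>, so the
  bound \<open>1 / (k + 1)\<close> is multiplied out first. \<open>L\<close> may be smaller than the
  set of all continuous functions, as the coded lattice is.\<close>

lemma (in positive_functional) tendsto_zero_compact_space:
  assumes X: "compact_space X" "topspace X = \<Omega>"
    and F: "\<And>n. F n \<in> L" "\<And>n. continuous_map X euclideanreal (F n)"
    and dec: "\<And>x. x \<in> \<Omega> \<Longrightarrow> decseq (\<lambda>n. F n x)"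
    and lim: "\<And>x. x \<in> \<Omega> \<Longrightarrow> (\<lambda>n. F n x) \<longlonglongrightarrow> 0"
  shows "(\<lambda>n. I (F n)) \<longlonglongrightarrow> 0"
proof (rule LIMSEQ_I)
  fix r :: real assume "0 < r"
  then obtain k where k: "1 / real (Suc k) < r"
    by (rule nat_approx_posE)
  have "\<exists>n. \<forall>x\<in>\<Omega>. F n x < 1 / real (Suc k)"
    unfolding X(2) [symmetric] by (rule dini [OF X(1) F(2) dec lim]) (simp_all add: X)
  then obtain n0 where n0: "\<And>x. x \<in> \<Omega> \<Longrightarrow> F n0 x < 1 / real (Suc k)"
    by blast
  have "norm (I (F n) - 0) < r" if n: "n0 \<le> n" for n
  proof -
    have small: "real (Suc k) * F n x \<le> 1" if x: "x \<in> \<Omega>" for x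
    proof -
      have "F n x \<le> 1 / real (Suc k)"
        using n0 [OF x] decseqD [OF dec [OF x] n] by linarith
      then show ?thesis by (simp add: field_simps)
    qed
    have "real (Suc k) * I (F n) \<le> I (\<lambda>_. 1)"
      unfolding I_scale_nat [OF F(1), symmetric] by (intro I_mono scale_nat F one small)
    then have "I (F n) \<le> 1 / real (Suc k)"
      by (simp add: I_one field_simps)
    moreover have "0 \<le> I (F n)"
      by (rule I_nonneg [OF F(1)]) (rule decseq_ge [OF dec lim])
    ultimately show ?thesis using k by simp
  qed
  then show "\<exists>n0. \<forall>n\<ge>n0. norm (I (F n) - 0) < r" by blast
qed

text \<open>A measure is identified with the functional it defines; by Tychonoff's theorem the positive
  normalized functionals form a compact set, and Daniell's theorem maps it continuously onto the
  measures.\<close>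
theorem compactin_weak_topology_constrained:
  fixes X :: "'a topology"
  assumes gen: "generated_by_continuous X"
    and W: "\<And>f c. (f, c) \<in> W \<Longrightarrow> f \<in> bounded_continuous X"
    and cont: "\<And>\<phi> F. \<lbrakk>positive_functional (topspace X) (bounded_continuous X) \<phi>; \<And>f c. (f, c) \<in> W \<Longrightarrow> \<phi> f = c;
      \<And>n. F n \<in> bounded_continuous X; \<And>x. x \<in> topspace X \<Longrightarrow> decseq (\<lambda>n. F n x);
      \<And>x. x \<in> topspace X \<Longrightarrow> (\<lambda>n. F n x) \<longlonglongrightarrow> 0\<rbrakk> \<Longrightarrow> (\<lambda>n. \<phi> (F n)) \<longlonglongrightarrow> 0"
  shows "compactin (weak_topology X) {M \<in> borel_prob X. \<forall>(f, c)\<in>W. (\<integral>x. f x \<partial>M) = c}"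
proof -
  let ?C = "bounded_continuous X"
  obtain B0 where B0: "\<And>f x. f \<in> ?C \<Longrightarrow> x \<in> topspace X \<Longrightarrow> \<bar>f x\<bar> \<le> B0 f"
    using bc.bounded [of _ X] by metis
  \<comment> \<open>Off \<open>?C\<close> the bound is 0, which freezes those coordinates; the cube
    can then be indexed by all functions and is still compact.\<close>
  define B where "B f = (if f \<in> ?C then B0 f else 0)" for f
  define K1 where "K1 = {\<phi> :: ('a \<Rightarrow> real) \<Rightarrow> real. \<phi> (\<lambda>_. 1) = 1 \<and>
    (\<forall>f g. f \<in> ?C \<and> g \<in> ?C \<longrightarrow> \<phi> (\<lambda>x. f x + g x) = \<phi> f + \<phi> g) \<and>
    (\<forall>f. f \<in> ?C \<and> (\<forall>x\<in>topspace X. 0 \<le> f x) \<longrightarrow> 0 \<le> \<phi> f) \<and>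
    (\<forall>f c. (f, c) \<in> W \<longrightarrow> \<phi> f = c)}"
  define K where "K = (\<Pi>\<^sub>E f\<in>UNIV. {- B f..B f}) \<inter> K1"
  have "compact (\<Pi>\<^sub>E f\<in>UNIV. {- B f..B f})"
    using compactin_PiE [of "\<lambda>_. euclideanreal" UNIV "\<lambda>f. {- B f..B f}"]
    by (simp add: euclidean_product_topology)
  \<comment> \<open>Each condition compares finitely many coordinates of \<phi>, which are
    continuous in the product topology. Daniell continuity is not of this kind and enters through
    \<open>cont\<close>.\<close>
  moreover have "closed K1"
    unfolding K1_def
    by (intro closed_Collect_conj closed_Collect_all closed_Collect_imp closed_Collect_eq
        closed_Collect_le open_Collect_const continuous_intros continuous_on_product_coordinates)
  ultimately have "compact K"
    unfolding K_def by (rule compact_Int_closed)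
  have daniell: "daniell_functional (topspace X) ?C \<phi>" if "\<phi> \<in> K" for \<phi>
  proof (rule daniell_functional.intro)
    show pos: "positive_functional (topspace X) ?C \<phi>"
      by unfold_locales (use that in \<open>auto simp: K_def K1_def\<close>)
    show "daniell_functional_axioms (topspace X) ?C \<phi>"
    proof
      show "(\<lambda>n. \<phi> (F n)) \<longlonglongrightarrow> 0"
      if "\<And>n. F n \<in> ?C" "\<And>x. x \<in> topspace X \<Longrightarrow> decseq (\<lambda>n. F n x)"
        "\<And>x. x \<in> topspace X \<Longrightarrow> (\<lambda>n. F n x) \<longlonglongrightarrow> 0" for F
      by (rule cont [OF pos]) (use \<open>\<phi> \<in> K\<close> that in \<open>auto simp: K_def K1_def\<close>)
    qed
  qed
  define s where "s = daniell_functional.daniell_measure (topspace X) ?C"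
  have s_prob: "s \<phi> \<in> borel_prob X" if "\<phi> \<in> K" for \<phi>
    using daniell_functional.prob_space_daniell_measure [OF daniell [OF that]]
      daniell_functional.sets_daniell_measure [OF daniell [OF that]] gen
    by (simp add: borel_prob_def s_def generated_by_continuous_def)
  have s_int: "(\<integral>x. f x \<partial>s \<phi>) = \<phi> f" if "\<phi> \<in> K" "f \<in> ?C" for \<phi> f
    unfolding s_def by (rule daniell_functional.integral_daniell_measure [OF daniell]) fact+
  have "continuous_map (top_of_set K) (weak_topology X) s"
  proof (rule continuous_map_into_weak_topology)
    fix f assume "f \<in> ?C"
    have "continuous_map (top_of_set K) euclideanreal (\<lambda>\<phi>. \<phi> f)"
      by (auto intro: continuous_on_product_coordinates continuous_on_subset)
    then show "continuous_map (top_of_set K) euclideanreal (\<lambda>\<phi>. \<integral>y. f y \<partial>s \<phi>)"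
      by (rule continuous_map_eq) (simp add: s_int \<open>f \<in> ?C\<close>)
  qed (simp add: s_prob)
  moreover have "compactin (top_of_set K) K"
    using \<open>compact K\<close> by (simp add: compactin_subtopology)
  ultimately have "compactin (weak_topology X) (s ` K)"
    by (rule image_compactin [rotated])
  also have "s ` K = {M \<in> borel_prob X. \<forall>(f, c)\<in>W. (\<integral>x. f x \<partial>M) = c}"
  proof safe
    fix \<phi> f c assume "\<phi> \<in> K" "(f, c) \<in> W"
    then show "(\<integral>x. f x \<partial>s \<phi>) = c"
      using W by (subst s_int) (auto simp: K_def K1_def)
  next
    fix M assume M: "M \<in> borel_prob X" and MW: "\<forall>(f, c)\<in>W. (\<integral>x. f x \<partial>M) = c"
    interpret prob_space M using M by (rule borel_probD)
    note int = bounded_continuous_integrable [OF _ M]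
    define \<phi> where "\<phi> f = (if f \<in> ?C then \<integral>x. f x \<partial>M else 0)" for f
    have "\<bar>\<integral>x. f x \<partial>M\<bar> \<le> B0 f" if f: "f \<in> ?C" for f
    proof -
      have *: "- B0 f \<le> f x" "f x \<le> B0 f" if "x \<in> space M" for x
        using B0 [OF f, of x] that by (auto simp: borel_probD [OF M])
      have "- B0 f \<le> (\<integral>x. f x \<partial>M)"
        by (intro integral_ge_const int f AE_I2 *)
      moreover have "(\<integral>x. f x \<partial>M) \<le> B0 f"
        by (intro integral_le_const int f AE_I2 *)
      ultimately show ?thesis by linarith
    qed
    then have "\<phi> \<in> (\<Pi>\<^sub>E f\<in>UNIV. {- B f..B f})"
      by (auto simp: \<phi>_def B_def abs_le_iff minus_le_iff)
    moreover have "\<phi> \<in> K1"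
      unfolding K1_def \<phi>_def using MW W
      by (auto simp: bc.one bc.add int prob_space [unfolded borel_probD [OF M]] borel_probD [OF M] intro!: integral_nonneg_AE AE_I2)
    ultimately have "\<phi> \<in> K" by (simp add: K_def)
    \<comment> \<open>\<open>s\<close> reproduces the integrals of \<open>M\<close>, and these
      determine \<open>M\<close> by \<open>gen\<close>; hence every constrained measure is in the
      image.\<close>
    moreover have "s \<phi> = M"
      using \<open>\<phi> \<in> K\<close> by (intro borel_prob_eqI [OF gen] s_prob M) (auto simp: s_int \<phi>_def)
    ultimately show "M \<in> s ` K" by blast
  qed (use s_prob in auto)
  finally show ?thesis .
qed

text \<open>A compact metrizable space presented by a countable separating family instead of a
  metric: the family passes to countable powers and supplies the measurable functions that generate
  the Borel sets.\<close>

locale separated_compact =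
  fixes X :: "'a topology" and e :: "'i::countable \<Rightarrow> 'a \<Rightarrow> real"
  assumes compact: "compact_space X"
    and continuous: "\<And>i. continuous_map X euclideanreal (e i)"
    and separating: "x \<in> topspace X \<Longrightarrow> y \<in> topspace X \<Longrightarrow> (\<And>i. e i x = e i y) \<Longrightarrow> x = y"
begin

text \<open>\<open>e\<close> embeds \<open>X\<close> as a compact subset of a metrizable product of lines, where open sets are
  described by the distance to their complement.\<close>
lemma openin_positivity:
  assumes V: "openin X V"
  obtains f where "f \<in> bounded_continuous X" "V = {x \<in> topspace X. 0 < f x}"
    "\<And>M. (\<And>i. e i \<in> borel_measurable M) \<Longrightarrow> f \<in> borel_measurable M"
proof (cases "V = topspace X")
  \<comment> \<open>The distance \<open>infdist\<close> to the empty set is 0, so the whole space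
    needs its own function.\<close>
  case True
  show ?thesis by (rule that [OF bc.one]) (auto simp: True)
next
  case False
  define E where "E x i = e i x" for x i
  have E: "continuous_map X euclidean E"
    unfolding euclidean_product_topology [symmetric] continuous_map_componentwise_UNIV E_def
    using continuous by simp
  define C where "C = E ` (topspace X - V)"
  have "C \<noteq> {}" using False openin_subset [OF V] by (auto simp: C_def)
  have "compactin X (topspace X - V)"
    using compact V by (intro closedin_compact_space) auto
  then have "compact C"
    unfolding C_def using image_compactin [OF _ E] by simp
  then have "closed C" by (rule compact_imp_closed)
  define f where "f x = infdist (E x) C" for x
  have "continuous_map X euclideanreal (\<lambda>x. infdist (E x) C)"
    by (rule continuous_map_compose [OF E, unfolded comp_def, where g = "\<lambda>y. infdist y C"]) (auto intro: continuous_intros)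
  then have "f \<in> bounded_continuous X"
    unfolding f_def [abs_def] by (intro bounded_continuous_compact_space compact)
  moreover have "V = {x \<in> topspace X. 0 < f x}"
  proof -
    have "0 < f x \<longleftrightarrow> E x \<notin> C" for x
      unfolding f_def using in_closed_iff_infdist_zero [OF \<open>closed C\<close> \<open>C \<noteq> {}\<close>, of "E x"]
        infdist_nonneg [of "E x" C] by auto
    moreover have "E x \<in> C \<longleftrightarrow> x \<notin> V" if x: "x \<in> topspace X" for x
    proof -
      have "x = y" if "y \<in> topspace X" "E x = E y" for y
        using separating [OF x that(1)] that(2) by (metis E_def)
      then show ?thesis using x unfolding C_def by blast
    qed
    ultimately show ?thesis using openin_subset [OF V] by auto
  qed
  \<comment> \<open>\<open>f\<close> is a Borel function of the countably many coordinates
    \<open>e i x\<close>, so any sigma-algebra that makes these measurable will do.\<close>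
  moreover have "f \<in> borel_measurable M" if "\<And>i. e i \<in> borel_measurable M" for M
  proof -
    have "E \<in> borel_measurable M"
      unfolding E_def by (rule measurable_coordinatewise_then_product) (rule that)
    moreover have "(\<lambda>y. infdist y C) \<in> borel_measurable borel"
      by (intro borel_measurable_continuous_onI continuous_intros)
    ultimately show ?thesis
      unfolding f_def [abs_def] by (rule measurable_compose [of E M borel])
  qed
  ultimately show ?thesis by (rule that)
qed

text \<open>For a power of the policy space this bounds the Borel sets from above by the
  sigma-algebra generated by rectangles.\<close>

lemma sets_borel_of_subset:
  assumes "space M = topspace X" "\<And>i. e i \<in> borel_measurable M"
  shows "sets (borel_of X) \<subseteq> sets M"
  unfolding sets_borel_of assms(1) [symmetric]
proof (rule sets.sigma_sets_subset, safe)
  fix V assume "openin X V"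
  then obtain f :: "'a \<Rightarrow> real" where f: "V = {x \<in> topspace X. 0 < f x}"
    "\<And>M. (\<And>i. e i \<in> borel_measurable M) \<Longrightarrow> f \<in> borel_measurable M"
    by (rule openin_positivity) blast
  have "f \<in> borel_measurable M"
    by (rule f(2)) (rule assms(2))
  then show "V \<in> sets M"
    unfolding f(1) assms(1) [symmetric] borel_measurable_iff_greater by blast
qed

lemma generated_by_continuous: "generated_by_continuous X"
  unfolding generated_by_continuous_def sets_borel_of
proof (rule sigma_sets_eqI)
  fix V assume "V \<in> {S. openin X S}"
  then obtain f where "f \<in> bounded_continuous X" "V = {x \<in> topspace X. 0 < f x}"
    using openin_positivity by blast
  then show "V \<in> sigma_sets (topspace X) (bc.positivity_sets X)"
    by (auto intro: bc.positivity_setsI)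
next
  fix V assume "V \<in> bc.positivity_sets X"
  then obtain f where "f \<in> bounded_continuous X" and V: "V = {x \<in> topspace X. 0 < f x}"
    by (auto simp: bc.positivity_sets_def)
  then have "openin X {x \<in> topspace X. f x \<in> {0<..}}"
    by (intro openin_continuous_map_preimage) (auto simp: bounded_continuous_def)
  then show "V \<in> sigma_sets (topspace X) {S. openin X S}"
    by (auto simp: V)
qed

theorem compactin_borel_prob: "compactin (weak_topology X) (borel_prob X)"
proof -
  have "compactin (weak_topology X) {M \<in> borel_prob X. \<forall>(f, c :: real)\<in>{}. (\<integral>x. f x \<partial>M) = c}"
  proof (rule compactin_weak_topology_constrained [OF generated_by_continuous])
    fix \<phi> F
    assume pos: "positive_functional (topspace X) (bounded_continuous X) \<phi>"
      and F: "\<And>n. F n \<in> bounded_continuous X"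
      and dec: "\<And>x. x \<in> topspace X \<Longrightarrow> decseq (\<lambda>n. F n x)"
      and lim: "\<And>x. x \<in> topspace X \<Longrightarrow> (\<lambda>n. F n x) \<longlonglongrightarrow> 0"
    have "continuous_map X euclideanreal (F n)" for n
      using F by (simp add: bounded_continuous_def)
    then show "(\<lambda>n. \<phi> (F n)) \<longlonglongrightarrow> 0"
      by (intro positive_functional.tendsto_zero_compact_space [OF pos compact refl F _ dec lim])
  qed simp
  then show ?thesis by simp
qed

end

section \<open>A countable determining lattice on Euclidean subsets\<close>

lemma continuous_map_measurable_borel_of:
  assumes "continuous_map X Z g"
  shows "g \<in> borel_of X \<rightarrow>\<^sub>M borel_of Z"
proof (rule measurable_sigma_sets [OF sets_borel_of])
  show "{S. openin Z S} \<subseteq> Pow (topspace Z)" by (auto dest: openin_subset)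
  show "g \<in> space (borel_of X) \<rightarrow> topspace Z"
    using continuous_map_image_subset_topspace [OF assms] by auto
  fix V assume "V \<in> {S. openin Z S}"
  then have "openin X {x \<in> topspace X. g x \<in> V}"
    using assms by (intro openin_continuous_map_preimage) auto
  moreover have "g -` V \<inter> space (borel_of X) = {x \<in> topspace X. g x \<in> V}" by auto
  ultimately show "g -` V \<inter> space (borel_of X) \<in> sets (borel_of X)"
    by (auto simp: sets_borel_of)
qed

text \<open>Codes for the function lattice generated by a sequence of functions; they make it countable.\<close>
datatype lattice_code = Gen nat | One | Sum lattice_code lattice_code | Neg lattice_code
  | Max lattice_code lattice_code

instance lattice_code :: countable
  by countable_datatype

primrec decode :: "(nat \<Rightarrow> 'a \<Rightarrow> real) \<Rightarrow> lattice_code \<Rightarrow> 'a \<Rightarrow> real" where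
  "decode G (Gen n) = G n"
| "decode G One = (\<lambda>_. 1)"
| "decode G (Sum a b) = (\<lambda>x. decode G a x + decode G b x)"
| "decode G (Neg a) = (\<lambda>x. - decode G a x)"
| "decode G (Max a b) = (\<lambda>x. max (decode G a x) (decode G b x))"

text \<open>Bounded but injective in each coordinate: \<open>tan\<close> recovers the coordinate.
  Enumerating the basis by naturals matches the index of \<open>Gen\<close>.\<close>

definition arctan_coord :: "nat \<Rightarrow> 'a::euclidean_space \<Rightarrow> real" where
  "arctan_coord n x = arctan (x \<bullet> from_nat_into Basis n)"

abbreviation coded :: "lattice_code \<Rightarrow> 'a::euclidean_space \<Rightarrow> real" where
  "coded \<equiv> decode arctan_coord"

definition coded_lattice :: "('a::euclidean_space \<Rightarrow> real) set" where
  "coded_lattice = range coded"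

lemma coded_bounded: "\<exists>B. \<forall>x::'a::euclidean_space. \<bar>coded c x\<bar> \<le> B"
proof (induction c)
  case (Gen n)
  have "\<bar>arctan y\<bar> \<le> 2" for y
    using arctan_bounded [of y] pi_less_4 by linarith
  then show ?case by (auto simp: arctan_coord_def)
next
  case (Sum a b)
  then obtain A B where AB: "\<bar>coded a x\<bar> \<le> A" "\<bar>coded b x\<bar> \<le> B" for x :: 'a
    by (elim exE) blast
  have "\<bar>coded (Sum a b) x\<bar> \<le> A + B" for x :: 'a
    unfolding decode.simps by (rule order_trans [OF abs_triangle_ineq add_mono [OF AB]])
  then show ?case by blast
next
  case (Max a b)
  then obtain A B where AB: "\<bar>coded a x\<bar> \<le> A" "\<bar>coded b x\<bar> \<le> B" for x :: 'a
    by (elim exE) blast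
  have "\<bar>coded (Max a b) x\<bar> \<le> max A B" for x :: 'a
    unfolding decode.simps by (rule order_trans [OF _ max.mono [OF AB, of x]]) (auto simp: max_def abs_if)
  then show ?case by blast
qed auto

lemma coded_continuous: "continuous_on S (coded c)"
  by (induction c) (auto simp: arctan_coord_def [abs_def] intro!: continuous_intros)

interpretation coded: function_lattice S coded_lattice for S :: "'a::euclidean_space set"
proof
  fix f g :: "'a \<Rightarrow> real" assume "f \<in> coded_lattice" "g \<in> coded_lattice"
  then obtain a b where ab: "f = coded a" "g = coded b" by (auto simp: coded_lattice_def)
  show "(\<lambda>x. f x + g x) \<in> coded_lattice"
    unfolding coded_lattice_def ab by (rule range_eqI [of _ _ "Sum a b"]) simp
  show "(\<lambda>x. max (f x) (g x)) \<in> coded_lattice"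
    unfolding coded_lattice_def ab by (rule range_eqI [of _ _ "Max a b"]) simp
next
  fix f :: "'a \<Rightarrow> real" assume "f \<in> coded_lattice"
  then obtain a where a: "f = coded a" by (auto simp: coded_lattice_def)
  show "(\<lambda>x. - f x) \<in> coded_lattice"
    unfolding coded_lattice_def a by (rule range_eqI [of _ _ "Neg a"]) simp
  show "\<exists>B. \<forall>x\<in>S. \<bar>f x\<bar> \<le> B" using coded_bounded a by blast
next
  show "(\<lambda>_. 1) \<in> (coded_lattice :: ('a \<Rightarrow> real) set)"
    unfolding coded_lattice_def by (rule range_eqI [of _ _ One]) simp
qed

lemma coded_lattice_continuous: "f \<in> coded_lattice \<Longrightarrow> continuous_on S f"
  by (auto simp: coded_lattice_def coded_continuous)

lemma coded_lattice_bounded_continuous: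
  "f \<in> coded_lattice \<Longrightarrow> f \<in> bounded_continuous (top_of_set S)"
  using coded.bounded [of f UNIV] coded_lattice_continuous [of f S]
  by (auto intro: bounded_continuousI)

lemma sets_borel_of_coded:
  fixes S :: "'a::euclidean_space set"
  shows "sets (borel_of (top_of_set S)) = sigma_sets S (coded.positivity_sets S)"
proof
  define M where "M = sigma S (coded.positivity_sets S)"
  have sM: "sets M = sigma_sets S (coded.positivity_sets S)" and spM: "space M = S"
    using coded.positivity_sets_subset [of S] by (auto simp: M_def sets_measure_of space_measure_of)
  have "(\<lambda>x. x \<bullet> b) \<in> borel_measurable M" if b: "b \<in> Basis" for b :: 'a
  proof -
    obtain n where n: "b = from_nat_into Basis n"
      using b from_nat_into_surj [of "Basis :: 'a set" b] countable_finite [OF finite_Basis] by metis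
    have "coded (Gen n) \<in> borel_measurable M"
      by (rule coded.measurable [OF _ sM]) (simp add: coded_lattice_def del: decode.simps)
    then have [measurable]: "(\<lambda>x. arctan (x \<bullet> b)) \<in> borel_measurable M"
      by (simp add: n arctan_coord_def [abs_def])
    have "(\<lambda>x. tan (arctan (x \<bullet> b))) \<in> borel_measurable M"
      unfolding tan_def by measurable
    then show ?thesis by (simp only: tan_arctan)
  qed
  then have "(\<lambda>x. x) \<in> borel_measurable M"
    by (subst borel_measurable_euclidean_space) auto
  then have "(\<lambda>x. x) -` T \<inter> S \<in> sets M" if "T \<in> sets borel" for T
    using that spM by (metis measurable_sets)
  then show "sets (borel_of (top_of_set S)) \<subseteq> sigma_sets S (coded.positivity_sets S)"
    unfolding sets_borel_of_top_of_set sM [symmetric] by (auto simp: sets_restrict_space Int_commute)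
next
  show "sigma_sets S (coded.positivity_sets S) \<subseteq> sets (borel_of (top_of_set S))"
    unfolding sets_borel_of topspace_euclidean_subtopology
  proof (rule sigma_sets_mono, safe)
    fix V assume "V \<in> coded.positivity_sets S"
    then obtain f where "f \<in> coded_lattice" and V: "V = {x \<in> S. 0 < f x}"
      by (auto simp: coded.positivity_sets_def)
    then have "openin (top_of_set S) {x \<in> topspace (top_of_set S). f x \<in> {0<..}}"
      by (intro openin_continuous_map_preimage [where Y = euclideanreal]) (auto intro: coded_lattice_continuous)
    then show "V \<in> sigma_sets S {V. openin (top_of_set S) V}"
      by (auto simp: V)
  qed
qed

lemma generated_by_continuous_top_of_set:
  fixes S :: "'a::euclidean_space set"
  shows "generated_by_continuous (top_of_set S)"
  unfolding generated_by_continuous_def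
proof
  show "sets (borel_of (top_of_set S)) \<subseteq>
      sigma_sets (topspace (top_of_set S)) (bc.positivity_sets (top_of_set S))"
    unfolding sets_borel_of_coded topspace_euclidean_subtopology
    using bc.positivity_setsI [OF coded_lattice_bounded_continuous, of _ S]
    by (intro sigma_sets_mono') (auto simp: coded.positivity_sets_def)
  show "sigma_sets (topspace (top_of_set S)) (bc.positivity_sets (top_of_set S)) \<subseteq>
      sets (borel_of (top_of_set S))"
    unfolding sets_borel_of
  proof (rule sigma_sets_mono, safe)
    fix V assume "V \<in> bc.positivity_sets (top_of_set S)"
    then obtain f where "f \<in> bounded_continuous (top_of_set S)" and V: "V = {x \<in> topspace (top_of_set S). 0 < f x}"
      unfolding bc.positivity_sets_def by blast
    then have "openin (top_of_set S) {x \<in> topspace (top_of_set S). f x \<in> {0<..}}"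
      by (intro openin_continuous_map_preimage [where Y = euclideanreal]) (auto simp: bounded_continuous_def)
    then show "V \<in> sigma_sets (topspace (top_of_set S)) {V. openin (top_of_set S) V}"
      by (auto simp: V)
  qed
qed

text \<open>Countably many integrals tell measures apart; they will be the separating functions on
  the policy space.\<close>

lemma borel_prob_eqI_coded:
  fixes S :: "'a::euclidean_space set"
  assumes "M \<in> borel_prob (top_of_set S)" "N \<in> borel_prob (top_of_set S)"
    and "\<And>c. (\<integral>x. coded c x \<partial>M) = (\<integral>x. coded c x \<partial>N)"
  shows "M = N"
  using assms borel_probD [of M "top_of_set S"] borel_probD [of N "top_of_set S"]
  by (intro coded.measure_eqI [of M S N]) (auto simp: sets_borel_of_coded coded_lattice_def)

text \<open>The identity is measurable in both directions; second countability enters through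
  \<open>borel_prod\<close>.\<close>

lemma sets_borel_of_Times:
  fixes U :: "'u::second_countable_topology set" and Y :: "'y::second_countable_topology set"
  shows "sets (borel_of (top_of_set (U \<times> Y))) =
    sets (borel_of (top_of_set U) \<Otimes>\<^sub>M borel_of (top_of_set Y))"
proof
  let ?P = "borel_of (top_of_set U) \<Otimes>\<^sub>M borel_of (top_of_set Y)"
  let ?R = "borel_of (top_of_set (U \<times> Y))"
  have R: "sets ?R = sets (restrict_space (borel \<Otimes>\<^sub>M borel) (U \<times> Y))"
    unfolding sets_borel_of_top_of_set borel_prod ..
  have ident: "(\<lambda>x. x) \<in> borel_of (top_of_set S) \<rightarrow>\<^sub>M borel" for S :: "'z::topological_space set"
    unfolding measurable_cong_sets [OF sets_borel_of_top_of_set refl]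
    by (rule measurable_restrict_space1) simp
  have "(\<lambda>p. (fst p, snd p)) \<in> ?P \<rightarrow>\<^sub>M borel \<Otimes>\<^sub>M borel"
    by (intro measurable_Pair measurable_compose [OF measurable_snd ident]
        measurable_compose [OF measurable_fst ident])
  then have "(\<lambda>p. p) \<in> ?P \<rightarrow>\<^sub>M ?R"
    unfolding measurable_cong_sets [OF refl R]
    by (intro measurable_restrict_space2) (auto simp: space_pair_measure)
  then have "(\<lambda>p. p) -` A \<inter> space ?P \<in> sets ?P" if "A \<in> sets ?R" for A
    using that by (rule measurable_sets)
  moreover have "(\<lambda>p. p) -` A \<inter> space ?P = A" if "A \<in> sets ?R" for A
    using sets.sets_into_space [OF that] by (auto simp: space_pair_measure)
  ultimately show "sets ?R \<subseteq> sets ?P" by auto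
  have "(\<lambda>p. (fst p, snd p)) \<in> ?R \<rightarrow>\<^sub>M ?P"
    by (intro measurable_Pair continuous_map_measurable_borel_of)
      (auto intro!: continuous_map_into_subtopology continuous_intros)
  then have "(\<lambda>p. p) -` A \<inter> space ?R \<in> sets ?R" if "A \<in> sets ?P" for A
    using that by (auto dest: measurable_sets)
  moreover have "(\<lambda>p. p) -` A \<inter> space ?R = A" if "A \<in> sets ?P" for A
    using sets.sets_into_space [OF that] by (auto simp: space_pair_measure)
  ultimately show "sets ?P \<subseteq> sets ?R" by auto
qed

section \<open>Policies as measures with a given marginal\<close>

lemma joint_measure_borel_prob:
  fixes U :: "'u::second_countable_topology set" and Y :: "'y::second_countable_topology set"
  assumes Q: "Q \<in> borel_prob (top_of_set Y)"
    and \<gamma>: "\<gamma> \<in> borel_of (top_of_set Y) \<rightarrow>\<^sub>M prob_algebra (borel_of (top_of_set U))"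
  shows "joint_measure U Y Q \<gamma> \<in> borel_prob (top_of_set (U \<times> Y))"
proof -
  interpret Q: prob_space Q using Q by (rule borel_probD)
  have sets: "sets (joint_measure U Y Q \<gamma>) = sets (borel_of (top_of_set (U \<times> Y)))"
    unfolding joint_measure_def by (rule sets_bind) (simp_all add: Q.not_empty)
  have "space (joint_measure U Y Q \<gamma>) = U \<times> Y"
    using sets_eq_imp_space_eq [OF sets] by simp
  moreover have "emeasure (joint_measure U Y Q \<gamma>) (U \<times> Y) = 1"
  proof -
    have "prob_space (\<gamma> y) \<and> space (\<gamma> y) = U" if "y \<in> space Q" for y
      using measurable_space [OF \<gamma>, of y] that borel_probD(3) [OF Q]
      by (auto simp: space_prob_algebra dest: sets_eq_imp_space_eq)
    then have "emeasure (\<gamma> y) U = 1" if "y \<in> space Q" for y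
      using that prob_space.emeasure_space_1 [of "\<gamma> y"] by force
    then have "(\<integral>\<^sup>+y. emeasure (\<gamma> y) U * indicator Y y \<partial>Q) = (\<integral>\<^sup>+y. 1 \<partial>Q)"
      by (intro nn_integral_cong) (simp add: borel_probD(3) [OF Q])
    then show ?thesis
      using sets.top [of "borel_of (top_of_set U)"] sets.top [of "borel_of (top_of_set Y)"]
      by (subst emeasure_joint_measure [OF Q \<gamma>]) (simp_all add: Q.emeasure_space_1)
  qed
  ultimately have "prob_space (joint_measure U Y Q \<gamma>)"
    by (intro prob_spaceI) simp
  with sets show ?thesis by (simp add: borel_prob_def)
qed

lemma snd_measurable_borel_of:
  "snd \<in> borel_of (top_of_set (U \<times> Y)) \<rightarrow>\<^sub>M borel_of (top_of_set Y)"
  by (intro continuous_map_measurable_borel_of) (auto intro!: continuous_map_into_subtopology continuous_intros)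

lemma distr_snd_joint_measure:
  fixes U :: "'u::second_countable_topology set" and Y :: "'y::second_countable_topology set"
  assumes Q: "Q \<in> borel_prob (top_of_set Y)"
    and \<gamma>: "\<gamma> \<in> borel_of (top_of_set Y) \<rightarrow>\<^sub>M prob_algebra (borel_of (top_of_set U))"
  shows "distr (joint_measure U Y Q \<gamma>) (borel_of (top_of_set Y)) snd = Q"
proof (rule measure_eqI)
  let ?J = "joint_measure U Y Q \<gamma>"
  have J: "?J \<in> borel_prob (top_of_set (U \<times> Y))"
    using Q \<gamma> by (rule joint_measure_borel_prob)
  have meas: "snd \<in> ?J \<rightarrow>\<^sub>M borel_of (top_of_set Y)"
    unfolding measurable_cong_sets [OF borel_probD(2) [OF J] refl] by (rule snd_measurable_borel_of)
  fix B assume "B \<in> sets (distr ?J (borel_of (top_of_set Y)) snd)"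
  then have B: "B \<in> sets (borel_of (top_of_set Y))" by simp
  then have BY: "B \<subseteq> Y" using sets.sets_into_space by fastforce
  have "prob_space (\<gamma> y) \<and> space (\<gamma> y) = U" if "y \<in> space Q" for y
    using measurable_space [OF \<gamma>, of y] that borel_probD(3) [OF Q]
    by (auto simp: space_prob_algebra dest: sets_eq_imp_space_eq)
  then have one: "emeasure (\<gamma> y) U = 1" if "y \<in> space Q" for y
    using that prob_space.emeasure_space_1 [of "\<gamma> y"] by force
  have "emeasure (distr ?J (borel_of (top_of_set Y)) snd) B = emeasure ?J (U \<times> B)"
    using BY by (subst emeasure_distr [OF meas B]) (auto simp: borel_probD [OF J] intro!: arg_cong2 [where f = emeasure])
  also have "\<dots> = (\<integral>\<^sup>+y. emeasure (\<gamma> y) U * indicator B y \<partial>Q)"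
    using sets.top [of "borel_of (top_of_set U)"] B by (intro emeasure_joint_measure [OF Q \<gamma>]) auto
  also have "\<dots> = (\<integral>\<^sup>+y. indicator B y \<partial>Q)"
    by (intro nn_integral_cong) (simp add: one)
  also have "\<dots> = emeasure Q B"
    using B by (simp add: borel_probD [OF Q])
  finally show "emeasure (distr ?J (borel_of (top_of_set Y)) snd) B = emeasure Q B" .
qed (use Q in \<open>simp add: borel_probD\<close>)

lemma fst_bounded_continuous:
  "f \<in> bounded_continuous (top_of_set U) \<Longrightarrow> (\<lambda>p. f (fst p)) \<in> bounded_continuous (top_of_set (U \<times> Y))"
proof -
  assume "f \<in> bounded_continuous (top_of_set U)"
  then obtain B where "continuous_on U f" and B: "\<And>x. x \<in> U \<Longrightarrow> \<bar>f x\<bar> \<le> B"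
    by (rule bounded_continuousE) auto
  have "continuous_on (U \<times> Y) (\<lambda>p. f (fst p))"
    by (rule continuous_on_compose2 [OF \<open>continuous_on U f\<close>]) (auto intro: continuous_intros)
  then show ?thesis using B by (intro bounded_continuousI [of _ _ B]) auto
qed

lemma snd_bounded_continuous:
  "f \<in> bounded_continuous (top_of_set Y) \<Longrightarrow> (\<lambda>p. f (snd p)) \<in> bounded_continuous (top_of_set (U \<times> Y))"
proof -
  assume "f \<in> bounded_continuous (top_of_set Y)"
  then obtain B where "continuous_on Y f" and B: "\<And>x. x \<in> Y \<Longrightarrow> \<bar>f x\<bar> \<le> B"
    by (rule bounded_continuousE) auto
  have "continuous_on (U \<times> Y) (\<lambda>p. f (snd p))"
    by (rule continuous_on_compose2 [OF \<open>continuous_on Y f\<close>]) (auto intro: continuous_intros)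
  then show ?thesis using B by (intro bounded_continuousI [of _ _ B]) auto
qed

text \<open>The conditional expectations given \<open>y\<close> of countably many functions of \<open>u\<close> form, outside a
  null set, positive functionals on the coded lattice; compactness of \<open>U\<close> turns these into
  measures.\<close>
lemma disintegration:
  fixes U :: "'u::euclidean_space set" and Y :: "'y::euclidean_space set"
  assumes U: "compact U" and M: "M \<in> borel_prob (top_of_set (U \<times> Y))"
    and Q: "Q = distr M (borel_of (top_of_set Y)) snd"
  obtains \<gamma> where "\<gamma> \<in> borel_of (top_of_set Y) \<rightarrow>\<^sub>M prob_algebra (borel_of (top_of_set U))"
    "M = joint_measure U Y Q \<gamma>"
proof -
  let ?MU = "borel_of (top_of_set U)" and ?MY = "borel_of (top_of_set Y)"
  interpret M: prob_space M using M by (rule borel_probD)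
  have spM: "space M = U \<times> Y" and sM: "sets M = sets (borel_of (top_of_set (U \<times> Y)))"
    using borel_probD [OF M] by auto
  obtain u0 where u0: "u0 \<in> U" using M.not_empty spM by auto
  have snd_meas [measurable]: "snd \<in> M \<rightarrow>\<^sub>M ?MY"
    unfolding measurable_cong_sets [OF sM refl] by (rule snd_measurable_borel_of)
  have Qp: "Q \<in> borel_prob (top_of_set Y)"
    unfolding Q borel_prob_def using M.prob_space_distr [OF snd_meas] by simp
  interpret Q: prob_space Q using Qp by (rule borel_probD)
  have spQ: "space Q = Y" and sQ [measurable_cong]: "sets Q = sets ?MY"
    using borel_probD [OF Qp] by auto
  define F where "F = vimage_algebra (space M) snd ?MY"
  have snd_fun: "snd \<in> space M \<rightarrow> space ?MY" by (auto simp: spM)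
  have sF: "sets F = {snd -` A \<inter> space M | A. A \<in> sets ?MY}"
    unfolding F_def using snd_fun by (rule sets_vimage_algebra2)
  have spF: "space F = space M" by (simp add: F_def)
  have "subalgebra M F"
    unfolding subalgebra_def spF sF using snd_meas by (auto intro: measurable_sets)
  then interpret S: finite_measure_subalgebra M F by unfold_locales
  have snd_F: "snd \<in> F \<rightarrow>\<^sub>M ?MY"
    unfolding F_def using snd_fun by (rule measurable_vimage_algebra1)
  have section_F: "(\<lambda>y. (u0, y)) \<in> ?MY \<rightarrow>\<^sub>M F"
    unfolding F_def by (rule measurable_vimage_algebra2) (auto simp: spM u0)
  \<comment> \<open>\<open>F\<close> consists of preimages under \<open>snd\<close>, so the level
    set of \<open>g\<close> through \<open>p\<close> contains the whole fibre of
    \<open>p\<close>.\<close>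
  have factor: "g p = g p'"
    if g: "g \<in> borel_measurable F" and p: "p \<in> space M" "p' \<in> space M" "snd p = snd p'"
    for g :: "'u \<times> 'y \<Rightarrow> real" and p p'
  proof -
    have "g -` {g p} \<inter> space F \<in> sets F"
      by (intro measurable_sets [OF g]) simp
    then obtain B where "g -` {g p} \<inter> space M = snd -` B \<inter> space M"
      unfolding spF sF by blast
    then show ?thesis using p by (metis (mono_tags, lifting) IntI IntD1 vimageI2 vimage_eq singletonD insertI1)
  qed
  \<comment> \<open>By \<open>factor\<close> the value at \<open>(u0, y)\<close> is the value at
    every \<open>(u, y)\<close>, so \<open>c h\<close> is the conditional expectation read as a
    function of \<open>y\<close>.\<close>
  define c where "c h y = real_cond_exp M F (\<lambda>p. h (fst p)) (u0, y)" for h :: "'u \<Rightarrow> real" and y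
  have c_snd: "real_cond_exp M F (\<lambda>p. h (fst p)) p = c h (snd p)" if "p \<in> space M" for h p
    unfolding c_def using that by (intro factor borel_measurable_cond_exp) (auto simp: spM u0)
  have c_meas [measurable]: "c h \<in> borel_measurable ?MY" for h
    unfolding c_def by (rule measurable_compose [OF section_F borel_measurable_cond_exp])
  have int: "integrable M (\<lambda>p. h (fst p))" if "h \<in> coded_lattice" for h :: "'u \<Rightarrow> real"
    using that by (intro bounded_continuous_integrable [OF fst_bounded_continuous M]
        coded_lattice_bounded_continuous)
  have c_int: "(\<integral>y. c h y * indicator B y \<partial>Q) = (\<integral>p. h (fst p) * indicator B (snd p) \<partial>M)"
    if h: "h \<in> coded_lattice" and B [measurable]: "B \<in> sets ?MY" for h B
  proof -
    have "(\<integral>y. c h y * indicator B y \<partial>Q) = (\<integral>p. c h (snd p) * indicator B (snd p) \<partial>M)"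
      unfolding Q by (intro integral_distr) auto
    also have "\<dots> = (\<integral>p. indicator B (snd p) * real_cond_exp M F (\<lambda>p. h (fst p)) p \<partial>M)"
      by (intro Bochner_Integration.integral_cong) (simp_all add: c_snd)
    also have "\<dots> = (\<integral>p. indicator B (snd p) * h (fst p) \<partial>M)"
    proof (rule S.real_cond_exp_intg(2))
      show "(\<lambda>p. indicator B (snd p)) \<in> borel_measurable F"
        by (rule measurable_compose [OF snd_F]) measurable
      show "(\<lambda>p. h (fst p)) \<in> borel_measurable M" using int [OF h] by auto
      then show "integrable M (\<lambda>p. indicator B (snd p) * h (fst p))"
        by (intro Bochner_Integration.integrable_bound [OF int [OF h]]) (auto simp: indicator_def)
    qed
    finally show ?thesis by (simp add: mult.commute)
  qed
  \<comment> \<open>The requirements of a positive functional on the coded lattice. They are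
    countably many, so almost every \<open>y\<close> meets all of them at once.\<close>
  define good where "good y \<longleftrightarrow> c (\<lambda>_. 1) y = 1 \<and>
    (\<forall>a b. c (\<lambda>x. coded a x + coded b x) y = c (coded a) y + c (coded b) y) \<and>
    (\<forall>a. (\<forall>x\<in>U. 0 \<le> coded a x) \<longrightarrow> 0 \<le> c (coded a) y)" for y
  have good_meas [measurable]: "Measurable.pred ?MY good"
    unfolding good_def [abs_def] by measurable
  have AE_c: "AE p in M. c (\<lambda>_. 1) (snd p) = 1"
    "AE p in M. c (\<lambda>x. coded a x + coded b x) (snd p) = c (coded a) (snd p) + c (coded b) (snd p)"
    "\<forall>x\<in>U. 0 \<le> coded a x \<Longrightarrow> AE p in M. 0 \<le> c (coded a) (snd p)" for a b
  proof -
    have lat: "coded d \<in> coded_lattice" for d by (simp add: coded_lattice_def)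
    have "AE p in M. real_cond_exp M F (\<lambda>p. 1) p = 1"
      by (rule S.real_cond_exp_F_meas) auto
    then show "AE p in M. c (\<lambda>_. 1) (snd p) = 1"
      by (rule AE_mp) (auto intro!: AE_I2 simp flip: c_snd)
    have "AE p in M. real_cond_exp M F (\<lambda>p. coded a (fst p) + coded b (fst p)) p =
        real_cond_exp M F (\<lambda>p. coded a (fst p)) p + real_cond_exp M F (\<lambda>p. coded b (fst p)) p"
      by (intro S.real_cond_exp_add int lat)
    then show "AE p in M. c (\<lambda>x. coded a x + coded b x) (snd p) = c (coded a) (snd p) + c (coded b) (snd p)"
      by (rule AE_mp) (auto intro!: AE_I2 simp flip: c_snd)
    assume "\<forall>x\<in>U. 0 \<le> coded a x"
    then have "AE p in M. 0 \<le> real_cond_exp M F (\<lambda>p. coded a (fst p)) p"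
      using int [OF lat] by (intro S.real_cond_exp_pos AE_I2) (auto simp: spM)
    then show "AE p in M. 0 \<le> c (coded a) (snd p)"
      by (rule AE_mp) (auto intro!: AE_I2 simp flip: c_snd)
  qed
  have "AE p in M. good (snd p)"
    unfolding good_def AE_conj_iff AE_all_countable using AE_c by auto
  moreover have "{y \<in> space ?MY. good y} \<in> sets ?MY" by measurable
  ultimately have AE_good: "AE y in Q. good y"
    unfolding Q by (subst AE_distr_iff [OF snd_meas]) auto
  \<comment> \<open>Evaluation at \<open>u0\<close> is itself a positive functional, so the
    exceptional \<open>y\<close> also receive one and the kernel is defined everywhere.\<close>
  define I where "I y h = (if good y then c h y else h u0)" for y and h :: "'u \<Rightarrow> real"
  have I_meas [measurable]: "(\<lambda>y. I y h) \<in> borel_measurable ?MY" for h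
    unfolding I_def by measurable
  have pos: "positive_functional U coded_lattice (I y)" for y
  proof
    fix f g :: "'u \<Rightarrow> real" assume f: "f \<in> coded_lattice"
    then obtain a where a: "f = coded a" by (auto simp: coded_lattice_def)
    show "0 \<le> I y f" if "\<And>x. x \<in> U \<Longrightarrow> 0 \<le> f x"
      using that u0 by (auto simp: I_def good_def a)
    assume "g \<in> coded_lattice"
    then obtain b where "g = coded b" by (auto simp: coded_lattice_def)
    with a show "I y (\<lambda>x. f x + g x) = I y f + I y g"
      by (auto simp: I_def good_def)
  qed (auto simp: I_def good_def)
  have daniell: "daniell_functional U coded_lattice (I y)" for y
  proof (rule daniell_functional.intro [OF pos], unfold_locales)
    fix G :: "nat \<Rightarrow> 'u \<Rightarrow> real"
    assume G: "\<And>n. G n \<in> coded_lattice" and dec: "\<And>x. x \<in> U \<Longrightarrow> decseq (\<lambda>n. G n x)"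
      and lim: "\<And>x. x \<in> U \<Longrightarrow> (\<lambda>n. G n x) \<longlonglongrightarrow> 0"
    show "(\<lambda>n. I y (G n)) \<longlonglongrightarrow> 0"
      by (rule positive_functional.tendsto_zero_compact_space [OF pos, where X = "top_of_set U"])
        (use U G dec lim in \<open>auto intro: coded_lattice_continuous simp: compact_space_subtopology\<close>)
  qed
  define \<kappa> where "\<kappa> y = daniell_functional.daniell_measure U coded_lattice (I y)" for y
  have \<kappa>_prob: "prob_space (\<kappa> y)" for y
    unfolding \<kappa>_def by (rule daniell_functional.prob_space_daniell_measure [OF daniell])
  have \<kappa>_sets: "sets (\<kappa> y) = sigma_sets U (coded.positivity_sets U)" for y
    unfolding \<kappa>_def by (rule daniell_functional.sets_daniell_measure [OF daniell])
  have \<kappa>_int: "(\<integral>x. h x \<partial>\<kappa> y) = I y h" if "h \<in> coded_lattice" for h y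
    unfolding \<kappa>_def by (rule daniell_functional.integral_daniell_measure [OF daniell that])
  have \<kappa>_lim: "(\<lambda>n. I y (coded.clip n f)) \<longlonglongrightarrow> measure (\<kappa> y) {x \<in> U. 0 < f x}"
    if f: "f \<in> coded_lattice" for f y
    using coded.measure_clip_tendsto [OF f \<kappa>_sets prob_space.finite_measure [OF \<kappa>_prob]]
    by (simp add: \<kappa>_int coded.clip [OF f])
  have measure_meas: "(\<lambda>y. measure (\<kappa> y) {x \<in> U. 0 < f x}) \<in> borel_measurable ?MY"
    if "f \<in> coded_lattice" for f
    by (rule borel_measurable_LIMSEQ_real [OF \<kappa>_lim [OF that]]) measurable
  have emeasure_\<kappa>: "emeasure (\<kappa> y) A = ennreal (measure (\<kappa> y) A)" for y A
    using prob_space.finite_measure [OF \<kappa>_prob] by (rule finite_measure.emeasure_eq_measure)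
  \<comment> \<open>Measurability in \<open>y\<close> is tested on the pi-system of positivity sets,
    where the measure is a limit of the measurable functions
    \<open>I y (coded.clip n f)\<close>.\<close>
  have \<kappa>: "\<kappa> \<in> ?MY \<rightarrow>\<^sub>M prob_algebra ?MU"
  proof (rule measurable_prob_algebra_generated [OF sets_borel_of_coded
        coded.Int_stable_positivity_sets coded.positivity_sets_subset])
    fix A assume "A \<in> coded.positivity_sets U"
    then obtain f where "f \<in> coded_lattice" "A = {x \<in> U. 0 < f x}"
      by (auto simp: coded.positivity_sets_def)
    then show "(\<lambda>y. emeasure (\<kappa> y) A) \<in> borel_measurable ?MY"
      using measure_meas unfolding emeasure_\<kappa> by auto
  qed (simp_all add: \<kappa>_prob \<kappa>_sets sets_borel_of_coded)
  let ?J = "joint_measure U Y Q \<kappa>"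
  have J: "?J \<in> borel_prob (top_of_set (U \<times> Y))"
    using Qp \<kappa> by (rule joint_measure_borel_prob)
  define E where "E = {A \<times> B | A B. A \<in> coded.positivity_sets U \<and> B \<in> sets ?MY}"
  have gen: "sets (borel_of (top_of_set (U \<times> Y))) = sigma_sets (U \<times> Y) E"
  proof -
    have "sets (?MU \<Otimes>\<^sub>M ?MY) =
        sets (sigma (space ?MU \<times> space ?MY) {A \<times> B | A B. A \<in> coded.positivity_sets U \<and> B \<in> sets ?MY})"
    proof (rule sets_pair_eq)
      show "coded.positivity_sets U \<subseteq> Pow (space ?MU)"
        using coded.positivity_sets_subset by simp
      show "sets ?MU = sigma_sets (space ?MU) (coded.positivity_sets U)"
        by (simp add: sets_borel_of_coded)
      show "{U} \<subseteq> coded.positivity_sets U"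
        using coded.space_in_positivity_sets by simp
      show "sets ?MY \<subseteq> Pow (space ?MY)" by (rule sets.space_closed)
      show "sets ?MY = sigma_sets (space ?MY) (sets ?MY)" by (rule sets.sigma_sets_eq [symmetric])
      show "{Y} \<subseteq> sets ?MY" using sets.top [of ?MY] by simp
    qed auto
    moreover have "E \<subseteq> Pow (U \<times> Y)"
      using coded.positivity_sets_subset [of U] sets.space_closed [of ?MY] unfolding E_def by fastforce
    ultimately show ?thesis
      by (simp add: sets_borel_of_Times sets_measure_of flip: E_def)
  qed
  have "M = ?J"
  proof (rule measure_eqI_generator_eq [where E = E and A = "\<lambda>_. U \<times> Y"])
    show "Int_stable E"
    proof (rule Int_stableI)
      fix a b assume "a \<in> E" "b \<in> E"
      then obtain A B A' B' where "a = A \<times> B" "b = A' \<times> B'"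
        "A \<in> coded.positivity_sets U" "A' \<in> coded.positivity_sets U" "B \<in> sets ?MY" "B' \<in> sets ?MY"
        by (auto simp: E_def)
      moreover from this have "A \<inter> A' \<in> coded.positivity_sets U"
        using coded.Int_stable_positivity_sets by (auto dest: Int_stableD)
      ultimately show "a \<inter> b \<in> E"
        unfolding E_def by (auto simp: Times_Int_Times)
    qed
    show "E \<subseteq> Pow (U \<times> Y)"
      using coded.positivity_sets_subset [of U] sets.space_closed [of ?MY] unfolding E_def by fastforce
    show "sets M = sigma_sets (U \<times> Y) E" "sets ?J = sigma_sets (U \<times> Y) E"
      using sM borel_probD [OF J] gen by auto
    show "range (\<lambda>_. U \<times> Y) \<subseteq> E"
      using coded.space_in_positivity_sets [of U] sets.top [of ?MY] unfolding E_def by auto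
    show "emeasure M (U \<times> Y) \<noteq> \<infinity>" by simp
    fix X assume "X \<in> E"
    then obtain f B where f: "f \<in> coded_lattice" and B [measurable]: "B \<in> sets ?MY"
      and X: "X = {x \<in> U. 0 < f x} \<times> B"
      by (auto simp: E_def coded.positivity_sets_def)
    have BY: "B \<subseteq> Y" using sets.sets_into_space [OF B] by simp
    \<comment> \<open>On a rectangle both measures are limits of integrals of
      \<open>clip n f\<close> times the indicator of \<open>B\<close>. At each \<open>n\<close> the
      clip is in the coded lattice, where conditional expectation equates the two integrals.\<close>
    let ?a = "\<lambda>n. \<integral>p. coded.clip n f (fst p) * indicator B (snd p) \<partial>M"
    have "?a \<longlonglongrightarrow> (\<integral>p. indicator {x. 0 < f x} (fst p) * (indicator B (snd p) :: real) \<partial>M)"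
      using int [OF coded.clip [OF f]]
      by (intro coded.integral_clip_tendsto f M.finite_measure_axioms) (auto simp: indicator_def)
    also have "(\<integral>p. indicator {x. 0 < f x} (fst p) * (indicator B (snd p) :: real) \<partial>M) = (\<integral>p. (indicator X p :: real) \<partial>M)"
      using BY by (intro Bochner_Integration.integral_cong) (auto simp: X spM indicator_def)
    also have "\<dots> = measure M X"
    proof -
      have "X \<in> sets M" using \<open>X \<in> E\<close> unfolding sM gen by (rule sigma_sets.Basic)
      then show ?thesis by simp
    qed
    finally have lim_M: "?a \<longlonglongrightarrow> measure M X" .
    have "(\<lambda>n. \<integral>y. I y (coded.clip n f) * indicator B y \<partial>Q) \<longlonglongrightarrow>
        (\<integral>y. measure (\<kappa> y) {x \<in> U. 0 < f x} * indicator B y \<partial>Q)"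
    proof (rule integral_dominated_convergence [where w = "\<lambda>_. 1"])
      have "\<bar>I y (coded.clip n f)\<bar> \<le> 1" for y n
      proof -
        interpret \<kappa>: prob_space "\<kappa> y" by (rule \<kappa>_prob)
        have "integrable (\<kappa> y) (coded.clip n f)"
          by (rule coded.integrable [OF coded.clip [OF f] \<kappa>_sets \<kappa>.finite_measure_axioms])
        then have "0 \<le> (\<integral>x. coded.clip n f x \<partial>\<kappa> y)" "(\<integral>x. coded.clip n f x \<partial>\<kappa> y) \<le> 1"
          by (auto intro!: integral_nonneg_AE \<kappa>.integral_le_const AE_I2 coded.clip_bounds)
        then show ?thesis by (simp add: \<kappa>_int coded.clip [OF f])
      qed
      then show "AE y in Q. norm (I y (coded.clip n f) * indicator B y) \<le> 1" for n
        by (auto simp: indicator_def)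
      show "AE y in Q. (\<lambda>n. I y (coded.clip n f) * indicator B y) \<longlonglongrightarrow>
          measure (\<kappa> y) {x \<in> U. 0 < f x} * indicator B y"
        by (intro AE_I2 tendsto_mult \<kappa>_lim f tendsto_const)
      show "(\<lambda>y. measure (\<kappa> y) {x \<in> U. 0 < f x} * indicator B y) \<in> borel_measurable Q"
        using measure_meas [OF f] by measurable
    qed auto
    moreover have "(\<integral>y. I y (coded.clip n f) * indicator B y \<partial>Q) = ?a n" for n
    proof -
      have "(\<integral>y. I y (coded.clip n f) * indicator B y \<partial>Q) = (\<integral>y. c (coded.clip n f) y * indicator B y \<partial>Q)"
        using AE_good by (intro integral_cong_AE) (auto simp: I_def)
      then show ?thesis using c_int [OF coded.clip [OF f] B] by simp
    qed
    ultimately have "measure M X = (\<integral>y. measure (\<kappa> y) {x \<in> U. 0 < f x} * indicator B y \<partial>Q)"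
      using lim_M by (auto intro: LIMSEQ_unique)
    moreover have "emeasure ?J X = ennreal (\<integral>y. measure (\<kappa> y) {x \<in> U. 0 < f x} * indicator B y \<partial>Q)"
    proof -
      have "{x \<in> U. 0 < f x} \<in> sets ?MU"
        unfolding sets_borel_of_coded by (auto intro: coded.positivity_setsI f)
      then have "emeasure ?J X = (\<integral>\<^sup>+y. emeasure (\<kappa> y) {x \<in> U. 0 < f x} * indicator B y \<partial>Q)"
        unfolding X using B by (intro emeasure_joint_measure Qp \<kappa>)
      also have "\<dots> = (\<integral>\<^sup>+y. ennreal (measure (\<kappa> y) {x \<in> U. 0 < f x} * indicator B y) \<partial>Q)"
        by (intro nn_integral_cong) (auto simp: emeasure_\<kappa> indicator_def)
      also have "\<dots> = ennreal (\<integral>y. measure (\<kappa> y) {x \<in> U. 0 < f x} * indicator B y \<partial>Q)"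
        using measure_meas [OF f] prob_space.prob_le_1 [OF \<kappa>_prob]
        by (intro nn_integral_eq_integral Q.integrable_const_bound [of _ 1] AE_I2) (auto simp: indicator_def)
      finally show ?thesis .
    qed
    ultimately show "emeasure M X = emeasure ?J X"
      by (simp add: M.emeasure_eq_measure)
  qed simp
  with \<kappa> show ?thesis by (rule that)
qed

text \<open>The kernels themselves do not pass to weak limits, but a marginal fixed by continuous
  test functions does, and it has the form of constraint that the compactness theorem takes.\<close>

lemma policies_eq:
  fixes U :: "'u::euclidean_space set" and Y :: "'y::euclidean_space set"
  assumes U: "compact U" and Q: "Q \<in> borel_prob (top_of_set Y)"
  shows "policies U Y Q = {M \<in> borel_prob (top_of_set (U \<times> Y)).
    \<forall>f\<in>bounded_continuous (top_of_set Y). (\<integral>p. f (snd p) \<partial>M) = (\<integral>y. f y \<partial>Q)}"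
proof -
  let ?MY = "borel_of (top_of_set Y)"
  have marginal: "distr M ?MY snd \<in> borel_prob (top_of_set Y)"
    "f \<in> bounded_continuous (top_of_set Y) \<Longrightarrow> (\<integral>y. f y \<partial>distr M ?MY snd) = (\<integral>p. f (snd p) \<partial>M)"
    if M: "M \<in> borel_prob (top_of_set (U \<times> Y))" for M :: "('u \<times> 'y) measure" and f
  proof -
    have meas: "snd \<in> M \<rightarrow>\<^sub>M ?MY"
      unfolding measurable_cong_sets [OF borel_probD(2) [OF M] refl] by (rule snd_measurable_borel_of)
    then show "distr M ?MY snd \<in> borel_prob (top_of_set Y)"
      unfolding borel_prob_def using prob_space.prob_space_distr [OF borel_probD(1) [OF M]] by simp
    assume "f \<in> bounded_continuous (top_of_set Y)"
    then show "(\<integral>y. f y \<partial>distr M ?MY snd) = (\<integral>p. f (snd p) \<partial>M)"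
      by (intro integral_distr [OF meas] continuous_map_measurable) (auto simp: bounded_continuous_def)
  qed
  show ?thesis
  proof (intro set_eqI iffI)
    fix M assume "M \<in> policies U Y Q"
    then obtain \<gamma> where \<gamma>: "\<gamma> \<in> ?MY \<rightarrow>\<^sub>M prob_algebra (borel_of (top_of_set U))"
      and M: "M = joint_measure U Y Q \<gamma>"
      unfolding policies_def by blast
    have "M \<in> borel_prob (top_of_set (U \<times> Y))"
      unfolding M using Q \<gamma> by (rule joint_measure_borel_prob)
    then show "M \<in> {M \<in> borel_prob (top_of_set (U \<times> Y)).
        \<forall>f\<in>bounded_continuous (top_of_set Y). (\<integral>p. f (snd p) \<partial>M) = (\<integral>y. f y \<partial>Q)}"
      using marginal(2) [of M] distr_snd_joint_measure [OF Q \<gamma>] M by simp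
  next
    fix M assume "M \<in> {M \<in> borel_prob (top_of_set (U \<times> Y)).
        \<forall>f\<in>bounded_continuous (top_of_set Y). (\<integral>p. f (snd p) \<partial>M) = (\<integral>y. f y \<partial>Q)}"
    then have M: "M \<in> borel_prob (top_of_set (U \<times> Y))"
      and eq: "\<And>f. f \<in> bounded_continuous (top_of_set Y) \<Longrightarrow> (\<integral>p. f (snd p) \<partial>M) = (\<integral>y. f y \<partial>Q)"
      by simp_all
    have "Q = distr M ?MY snd"
      using marginal [OF M] eq
      by (intro borel_prob_eqI [OF generated_by_continuous_top_of_set Q]) auto
    then obtain \<gamma> where "\<gamma> \<in> ?MY \<rightarrow>\<^sub>M prob_algebra (borel_of (top_of_set U))"
      "M = joint_measure U Y Q \<gamma>"
      by (rule disintegration [OF U M])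
    then show "M \<in> policies U Y Q" unfolding policies_def by blast
  qed
qed

section \<open>Compactness of the policy space\<close>

text \<open>Lower semicontinuity holds for any pointwise supremum of continuous functions. Upper
  semicontinuity uses that the supremum is attained and that projection along the compact
  \<open>U\<close> is a closed map.\<close>

lemma continuous_map_compact_SUP:
  fixes U :: "'u::euclidean_space set" and Y :: "'y::euclidean_space set"
    and f :: "'u \<times> 'y \<Rightarrow> real"
  assumes U: "compact U" "U \<noteq> {}" and f: "continuous_on (U \<times> Y) f"
  shows "continuous_map (top_of_set Y) euclideanreal (\<lambda>y. SUP u\<in>U. f (u, y))"
  unfolding continuous_map_upper_lower_semicontinuous_lt topspace_euclidean_subtopology
proof (intro conjI allI)
  fix a :: real
  have slice: "continuous_on U (\<lambda>u. f (u, y))" if "y \<in> Y" for y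
    by (rule continuous_on_compose2 [OF f]) (use that in \<open>auto intro!: continuous_intros\<close>)
  have bdd: "bdd_above ((\<lambda>u. f (u, y)) ` U)" if "y \<in> Y" for y
    using compact_continuous_image [OF slice [OF that] U(1)]
    by (intro bounded_imp_bdd_above compact_imp_bounded)
  have "{y \<in> Y. a < (SUP u\<in>U. f (u, y))} = (\<Union>u\<in>U. {y \<in> Y. a < f (u, y)})"
    using less_cSUP_iff [OF U(2) bdd] by auto
  also have "openin (top_of_set Y) \<dots>"
  proof (intro openin_Union ballI, clarify)
    fix u assume "u \<in> U"
    then have "continuous_on Y (\<lambda>y. f (u, y))"
      by (intro continuous_on_compose2 [OF f]) (auto intro!: continuous_intros)
    then show "openin (top_of_set Y) {y \<in> Y. a < f (u, y)}"
      using openin_continuous_map_preimage [of "top_of_set Y" euclideanreal "\<lambda>y. f (u, y)" "{a<..}"] by simp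
  qed
  finally show "openin (top_of_set Y) {y \<in> Y. a < (SUP u\<in>U. f (u, y))}" .
  have "(SUP u\<in>U. f (u, y)) < a \<longleftrightarrow> (\<forall>u\<in>U. f (u, y) < a)" if y: "y \<in> Y" for y
  proof
    assume "(SUP u\<in>U. f (u, y)) < a"
    then show "\<forall>u\<in>U. f (u, y) < a"
      using cSUP_upper [OF _ bdd [OF that]] by (meson le_less_trans)
  next
    assume *: "\<forall>u\<in>U. f (u, y) < a"
    obtain u where u: "u \<in> U" "\<And>v. v \<in> U \<Longrightarrow> f (v, y) \<le> f (u, y)"
      using continuous_attains_sup [OF U slice [OF y]] by blast
    then have "(SUP u\<in>U. f (u, y)) \<le> f (u, y)"
      using U(2) by (intro cSUP_least)
    then show "(SUP u\<in>U. f (u, y)) < a"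
      using * u(1) by (meson le_less_trans)
  qed
  then have "{y \<in> Y. (SUP u\<in>U. f (u, y)) < a} = Y - snd ` {p \<in> U \<times> Y. a \<le> f p}"
    by (force simp: not_less)
  moreover have "closedin (top_of_set (U \<times> Y)) {p \<in> U \<times> Y. a \<le> f p}"
    using closedin_continuous_map_preimage [of "top_of_set (U \<times> Y)" euclideanreal f "{a..}"] f by simp
  then have "closedin (top_of_set Y) (snd ` {p \<in> U \<times> Y. a \<le> f p})"
    by (rule Starlike.closed_map_snd [OF U(1)])
  ultimately show "openin (top_of_set Y) {y \<in> Y. (SUP u\<in>U. f (u, y)) < a}"
    using openin_diff [OF openin_topspace] by fastforce
qed

text \<open>The supremum \<open>G n\<close> over \<open>U\<close> is continuous and decreases to 0
  by Dini in \<open>u\<close>. The constraints make \<phi> of \<open>G n\<close> its integral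
  against \<open>Q\<close>, where dominated convergence applies, and \<open>F n \<le> G n\<close>
  squeezes \<phi> of \<open>F n\<close> to 0.\<close>

lemma compactin_policies:
  fixes U :: "'u::euclidean_space set" and Y :: "'y::euclidean_space set"
  assumes U: "compact U" and Q: "Q \<in> borel_prob (top_of_set Y)"
  shows "compactin (weak_topology (top_of_set (U \<times> Y))) (policies U Y Q)"
proof -
  let ?X = "top_of_set (U \<times> Y)"
  define W where "W = (\<lambda>f. (\<lambda>p :: 'u \<times> 'y. f (snd p), \<integral>y. f y \<partial>Q)) ` bounded_continuous (top_of_set Y)"
  interpret Q: prob_space Q using Q by (rule borel_probD)
  have "compactin (weak_topology ?X) {M \<in> borel_prob ?X. \<forall>(f, c)\<in>W. (\<integral>x. f x \<partial>M) = c}"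
  proof (rule compactin_weak_topology_constrained [OF generated_by_continuous_top_of_set])
    show "f \<in> bounded_continuous ?X" if "(f, c) \<in> W" for f c
      using that by (auto simp: W_def intro: snd_bounded_continuous)
    fix \<phi> :: "('u \<times> 'y \<Rightarrow> real) \<Rightarrow> real" and F :: "nat \<Rightarrow> 'u \<times> 'y \<Rightarrow> real"
    assume \<phi>: "positive_functional (topspace ?X) (bounded_continuous ?X) \<phi>"
      and W: "\<And>f c. (f, c) \<in> W \<Longrightarrow> \<phi> f = c"
      and F: "\<And>n. F n \<in> bounded_continuous ?X"
      and dec: "\<And>x. x \<in> topspace ?X \<Longrightarrow> decseq (\<lambda>n. F n x)"
      and lim: "\<And>x. x \<in> topspace ?X \<Longrightarrow> (\<lambda>n. F n x) \<longlonglongrightarrow> 0"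
    interpret \<phi>: positive_functional "topspace ?X" "bounded_continuous ?X" \<phi> by fact
    show "(\<lambda>n. \<phi> (F n)) \<longlonglongrightarrow> 0"
    \<comment> \<open>With \<open>U\<close> empty there is no supremum to take, but all functions
      agree with 0 on the empty product.\<close>
    proof (cases "U = {}")
      case True
      then have "\<phi> (F n) = 0" for n
        using \<phi>.I_cong [OF F bc.zero] \<phi>.I_zero by simp
      then show ?thesis by simp
    next
      case False
      define G where "G n y = (SUP u\<in>U. F n (u, y))" for n y
      have F_cont: "continuous_on (U \<times> Y) (F n)" for n
        using F by (simp add: bounded_continuous_def)
      have G_cont: "continuous_map (top_of_set Y) euclideanreal (G n)" for n
        unfolding G_def by (rule continuous_map_compact_SUP [OF U False F_cont])
      have F_nonneg: "0 \<le> F n (u, y)" if "u \<in> U" "y \<in> Y" for n u y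
        using that by (intro decseq_ge [OF dec lim]) auto
      obtain B where B: "\<And>p. p \<in> U \<times> Y \<Longrightarrow> \<bar>F 0 p\<bar> \<le> B"
        using F [of 0] by (rule bounded_continuousE) auto
      have F_le: "F n (u, y) \<le> B" if "u \<in> U" "y \<in> Y" for n u y
        using decseqD [OF dec, of "(u, y)" 0 n] B [of "(u, y)"] that by auto
      have F_le_G: "F n (u, y) \<le> G n y" if "u \<in> U" "y \<in> Y" for n u y
        unfolding G_def using that F_le by (intro cSUP_upper bdd_aboveI2 [of _ _ B])
      have G_le: "G n y \<le> b" if "y \<in> Y" "\<And>u. u \<in> U \<Longrightarrow> F n (u, y) \<le> b" for n y b
        unfolding G_def using that False by (intro cSUP_least)
      have G_nonneg: "0 \<le> G n y" if "y \<in> Y" for n y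
        using False F_nonneg F_le_G that by (meson ex_in_conv order_trans)
      have G_abs: "\<bar>G n y\<bar> \<le> B" if "y \<in> Y" for n y
        using G_nonneg [OF that] G_le [OF that F_le] that by (simp add: abs_le_iff)
      have G: "G n \<in> bounded_continuous (top_of_set Y)" for n
        using G_cont G_abs by (intro bounded_continuousI [of _ _ B]) auto
      have G_lim: "(\<lambda>n. G n y) \<longlonglongrightarrow> 0" if y: "y \<in> Y" for y
      proof (rule LIMSEQ_I)
        fix r :: real assume "0 < r"
        have "\<exists>n. \<forall>u\<in>topspace (top_of_set U). F n (u, y) < r / 2"
        proof (rule dini)
          show "compact_space (top_of_set U)" using U by (simp add: compact_space_subtopology)
          have "continuous_on U (\<lambda>u. F n (u, y))" for n
            by (rule continuous_on_compose2 [OF F_cont]) (use y in \<open>auto intro!: continuous_intros\<close>)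
          then show "continuous_map (top_of_set U) euclideanreal (\<lambda>u. F n (u, y))" for n by simp
        qed (use dec lim y \<open>0 < r\<close> in auto)
        then obtain n0 where n0: "\<And>u. u \<in> U \<Longrightarrow> F n0 (u, y) < r / 2" by auto
        have "norm (G n y - 0) < r" if "n0 \<le> n" for n
        proof -
          have "F n (u, y) \<le> r / 2" if "u \<in> U" for u
            using decseqD [OF dec \<open>n0 \<le> n\<close>, of "(u, y)"] n0 [OF that] that y by auto
          then have "G n y \<le> r / 2" by (intro G_le y)
          then show ?thesis using G_nonneg [OF y, of n] \<open>0 < r\<close> by simp
        qed
        then show "\<exists>n0. \<forall>n\<ge>n0. norm (G n y - 0) < r" by blast
      qed
      have "(\<lambda>n. \<integral>y. G n y \<partial>Q) \<longlonglongrightarrow> (\<integral>y. 0 \<partial>Q)"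
      proof (rule integral_dominated_convergence [where w = "\<lambda>_. B"])
        show "G n \<in> borel_measurable Q" for n
          using bounded_continuous_integrable [OF G Q] by auto
      qed (auto simp: borel_probD [OF Q] G_lim G_abs)
      moreover have "\<phi> (\<lambda>p. G n (snd p)) = (\<integral>y. G n y \<partial>Q)" for n
        using G by (intro W) (auto simp: W_def)
      ultimately have lim_G: "(\<lambda>n. \<phi> (\<lambda>p. G n (snd p))) \<longlonglongrightarrow> 0" by simp
      show ?thesis
      proof (rule tendsto_sandwich [OF _ _ tendsto_const lim_G])
        show "\<forall>\<^sub>F n in sequentially. 0 \<le> \<phi> (F n)"
          using F F_nonneg by (intro always_eventually allI \<phi>.I_nonneg) auto
        show "\<forall>\<^sub>F n in sequentially. \<phi> (F n) \<le> \<phi> (\<lambda>p. G n (snd p))"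
          using F_le_G by (intro always_eventually allI \<phi>.I_mono F snd_bounded_continuous G) auto
      qed
    qed
  qed
  also have "{M \<in> borel_prob ?X. \<forall>(f, c)\<in>W. (\<integral>x. f x \<partial>M) = c} = policies U Y Q"
    unfolding policies_eq [OF U Q] W_def by auto
  finally show ?thesis .
qed

lemma separated_compact_policy_topology:
  fixes U :: "'u::euclidean_space set" and Y :: "'y::euclidean_space set"
  assumes U: "compact U" and Q: "Q \<in> borel_prob (top_of_set Y)"
  shows "separated_compact (policy_topology U Y Q) (\<lambda>c M. \<integral>p. coded c p \<partial>M)"
proof
  show "compact_space (policy_topology U Y Q)"
    unfolding policy_topology_def by (rule compact_space_subtopology [OF compactin_policies [OF U Q]])
  fix c :: lattice_code
  show "continuous_map (policy_topology U Y Q) euclideanreal (\<lambda>M. \<integral>p. coded c p \<partial>M)"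
    unfolding policy_topology_def
    by (intro continuous_map_from_subtopology continuous_map_integral coded_lattice_bounded_continuous)
      (simp add: coded_lattice_def)
next
  fix M N assume "M \<in> topspace (policy_topology U Y Q)" "N \<in> topspace (policy_topology U Y Q)"
    "\<And>c. (\<integral>p. coded c p \<partial>M) = (\<integral>p. coded c p \<partial>N)"
  then show "M = N"
    by (intro borel_prob_eqI_coded [of M "U \<times> Y" N]) (auto simp: policy_topology_def)
qed

text \<open>Pairs of a coordinate and a separating function are again countable. The constant 0
  fills in for indices outside \<open>I\<close>, where the product has no coordinate.\<close>

lemma separated_compact_product_topology:
  fixes e :: "'i::countable \<Rightarrow> 'a \<Rightarrow> real" and I :: "'k::countable set"
  assumes "separated_compact X e"
  shows "separated_compact (product_topology (\<lambda>_. X) I)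
    (\<lambda>(k, i) x. if k \<in> I then e i (x k) else 0)"
proof -
  interpret separated_compact X e by fact
  show ?thesis
  proof
    show "compact_space (product_topology (\<lambda>_. X) I)"
      using compact by (simp add: compact_space_product_topology)
    fix p :: "'k \<times> 'i"
    obtain k i where p: "p = (k, i)" by fastforce
    show "continuous_map (product_topology (\<lambda>_. X) I) euclideanreal
        ((\<lambda>(k, i) x. if k \<in> I then e i (x k) else 0) p)"
      unfolding p prod.case
    proof (cases "k \<in> I")
      case True
      have "continuous_map (product_topology (\<lambda>_. X) I) euclideanreal (e i \<circ> (\<lambda>x. x k))"
        using continuous_map_product_projection [OF True, of "\<lambda>_. X"] continuous
        by (rule continuous_map_compose)
      with True show "continuous_map (product_topology (\<lambda>_. X) I) euclideanreal
          (\<lambda>x. if k \<in> I then e i (x k) else 0)"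
        by (simp add: comp_def)
    qed simp
  next
    fix x y assume xy: "x \<in> topspace (product_topology (\<lambda>_. X) I)" "y \<in> topspace (product_topology (\<lambda>_. X) I)"
      and eq: "\<And>p. (\<lambda>(k, i) x. if k \<in> I then e i (x k) else 0) p x =
        (\<lambda>(k, i) x. if k \<in> I then e i (x k) else 0) p y"
    show "x = y"
    proof (rule PiE_ext)
      show "x \<in> (\<Pi>\<^sub>E k\<in>I. topspace X)" "y \<in> (\<Pi>\<^sub>E k\<in>I. topspace X)"
        using xy by simp_all
      fix k assume k: "k \<in> I"
      have "e i (x k) = e i (y k)" for i
        using eq [of "(k, i)"] k by simp
      then show "x k = y k"
        using xy k by (intro separating) auto
    qed
  qed
qed

section \<open>Exchangeable measures\<close>

definition rectangle :: "'a topology \<Rightarrow> nat set \<Rightarrow> nat \<Rightarrow> (nat \<Rightarrow> 'a set) \<Rightarrow> (nat \<Rightarrow> 'a) set" where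
  "rectangle Z I n A = {x \<in> topspace (product_topology (\<lambda>_. Z) I). \<forall>k\<in>{1..n}. x k \<in> A k}"

text \<open>Composition with \<sigma>, restricted so that the result is extensional and thus a point
  of the product over \<open>I\<close>.\<close>

definition reindex :: "(nat \<Rightarrow> nat) \<Rightarrow> nat set \<Rightarrow> (nat \<Rightarrow> 'a) \<Rightarrow> nat \<Rightarrow> 'a" where
  "reindex \<sigma> I x = (\<lambda>k\<in>I. x (\<sigma> k))"

lemma closedin_Collect_Ball_eq:
  fixes f g :: "'t \<Rightarrow> 'a \<Rightarrow> real"
  assumes "\<And>t. t \<in> T \<Longrightarrow> continuous_map X euclideanreal (f t)"
    and "\<And>t. t \<in> T \<Longrightarrow> continuous_map X euclideanreal (g t)"
  shows "closedin X {x \<in> topspace X. \<forall>t\<in>T. f t x = g t x}"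
proof (cases "T = {}")
  case False
  then have "{x \<in> topspace X. \<forall>t\<in>T. f t x = g t x} = (\<Inter>t\<in>T. {x \<in> topspace X. f t x = g t x})"
    by auto
  also have "closedin X \<dots>"
    using assms by (intro closedin_INT False closedin_continuous_maps_eq [where Y = euclideanreal]) auto
  finally show ?thesis .
qed simp

section \<open>Mixtures and convexity\<close>

lemma measure_mix_measure:
  assumes sets: "sets M = sets N" and "finite_measure M" "finite_measure N" and t: "t \<in> {0..1}"
  shows "measure (mix_measure t M N) A = t * measure M A + (1 - t) * measure N A"
proof (cases "A \<in> sets M")
  case True
  interpret M: finite_measure M by fact
  interpret N: finite_measure N by fact
  have "emeasure (mix_measure t M N) A = ennreal (t * measure M A + (1 - t) * measure N A)"
    using t by (simp add: emeasure_mix_measure [OF sets True] M.emeasure_eq_measure N.emeasure_eq_measure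
        ennreal_mult ennreal_plus)
  moreover have "0 \<le> t * measure M A + (1 - t) * measure N A"
    using t by simp
  ultimately show ?thesis
    unfolding measure_def [of "mix_measure t M N"] by (simp only: enn2real_ennreal)
next
  \<comment> \<open>Nonmeasurable sets have \<open>measure\<close> 0 on both sides. With all sets
    covered, mixing exchangeable measures involves no check that the events are measurable.\<close>
  case False
  then show ?thesis using sets by (simp add: measure_notin_sets)
qed

lemma mix_measure_borel_prob:
  assumes M: "M \<in> borel_prob X" and N: "N \<in> borel_prob X" and t: "t \<in> {0..1}"
  shows "mix_measure t M N \<in> borel_prob X"
proof -
  have sets: "sets M = sets N" "sets M = sets (borel_of X)"
    using borel_probD [OF M] borel_probD [OF N] by auto
  have space: "space (mix_measure t M N) = space M"
    by (rule sets_eq_imp_space_eq) simp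
  have "emeasure M (space M) = 1" "emeasure N (space M) = 1"
    using prob_space.emeasure_space_1 [OF borel_probD(1) [OF M]]
      prob_space.emeasure_space_1 [OF borel_probD(1) [OF N]]
    by (simp_all add: borel_probD(3) [OF M] borel_probD(3) [OF N])
  then have "emeasure (mix_measure t M N) (space M) = ennreal t + ennreal (1 - t)"
    by (simp add: emeasure_mix_measure [OF sets(1)])
  also have "\<dots> = 1"
    using t by (simp flip: ennreal_plus)
  finally have "prob_space (mix_measure t M N)"
    by (intro prob_spaceI) (simp add: space)
  then show ?thesis by (simp add: borel_prob_def borel_probD(2) [OF M])
qed

lemma exchangeable_uptoD:
  assumes "exchangeable_upto B n P" "\<And>k. k \<in> {1..n} \<Longrightarrow> A k \<in> sets B" "\<sigma> permutes {1..n}"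
  shows "measure P {x \<in> space P. \<forall>k\<in>{1..n}. x k \<in> A k} =
    measure P {x \<in> space P. \<forall>k\<in>{1..n}. x (\<sigma> k) \<in> A k}"
  by (rule assms(1) [unfolded exchangeable_upto_def, rule_format, OF assms(2,3)])

text \<open>Both sides of each exchangeability equation are affine in the measure.\<close>

lemma convex_measures_exchangeable:
  "convex_measures {P \<in> borel_prob X. \<forall>n\<in>\<N>. exchangeable_upto B n P}"
  unfolding convex_measures_def
proof (intro ballI)
  fix M N :: "(nat \<Rightarrow> 'a) measure" and t :: real
  assume M: "M \<in> {P \<in> borel_prob X. \<forall>n\<in>\<N>. exchangeable_upto B n P}"
    and N: "N \<in> {P \<in> borel_prob X. \<forall>n\<in>\<N>. exchangeable_upto B n P}" and t: "t \<in> {0..1}"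
  have "sets M = sets N" "finite_measure M" "finite_measure N"
    using M N borel_probD [of M X] borel_probD [of N X] prob_space.finite_measure by auto
  note mix = measure_mix_measure [OF this t]
  have "space (mix_measure t M N) = space M"
    by (rule sets_eq_imp_space_eq) simp
  moreover have "space N = space M"
    using M N borel_probD(3) [of M X] borel_probD(3) [of N X] by simp
  ultimately have space: "space (mix_measure t M N) = space M" "space N = space M"
    by simp_all
  have "exchangeable_upto B n (mix_measure t M N)" if n: "n \<in> \<N>" for n
    using M N n unfolding exchangeable_upto_def mix space by (auto simp: space)
  then show "mix_measure t M N \<in> {P \<in> borel_prob X. \<forall>n\<in>\<N>. exchangeable_upto B n P}"
    using M N t by (auto intro: mix_measure_borel_prob)
qed

text \<open>\<open>\<N>\<close> collects the \<open>n\<close> for which invariance under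
  permutations of \<open>{1..n}\<close> is demanded: \<open>{N}\<close> gives the finite team,
  \<open>UNIV\<close> the infinite one, and the index set is the union of the intervals.\<close>

locale exchangeability = separated_compact Z e
  for Z :: "'a topology" and e :: "'i::countable \<Rightarrow> 'a \<Rightarrow> real" +
  fixes I \<N> :: "nat set"
  assumes index: "I = (\<Union>n\<in>\<N>. {1..n})"
begin

abbreviation "K \<equiv> product_topology (\<lambda>_. Z) I"

sublocale K: separated_compact K "\<lambda>(k, i) x. if k \<in> I then e i (x k) else 0"
  by (rule separated_compact_product_topology) unfold_locales

lemma reindex_mem:
  assumes "n \<in> \<N>" "\<sigma> permutes {1..n}" "k \<in> I"
  shows "\<sigma> k \<in> I"
proof (cases "k \<in> {1..n}")
  case True
  then have "\<sigma> k \<in> {1..n}" using permutes_in_image [OF assms(2)] by blast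
  then show ?thesis using assms(1) index by auto
next
  case False
  then show ?thesis using assms(2,3) by (simp add: permutes_not_in)
qed

lemma continuous_map_reindex:
  assumes "n \<in> \<N>" "\<sigma> permutes {1..n}"
  shows "continuous_map K K (reindex \<sigma> I)"
  unfolding continuous_map_componentwise
proof (intro conjI ballI)
  show "reindex \<sigma> I ` topspace K \<subseteq> extensional I"
    by (auto simp: reindex_def)
  fix k assume k: "k \<in> I"
  then have "continuous_map K Z (\<lambda>x. x (\<sigma> k))"
    by (intro continuous_map_product_projection reindex_mem [OF assms])
  then show "continuous_map K Z (\<lambda>x. reindex \<sigma> I x k)"
    using k by (simp add: reindex_def)
qed

lemma coordinate_measurable: "k \<in> I \<Longrightarrow> (\<lambda>x. x k) \<in> borel_of K \<rightarrow>\<^sub>M borel_of Z"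
  by (intro continuous_map_measurable_borel_of continuous_map_product_projection)

lemma interval_subset_index: "n \<in> \<N> \<Longrightarrow> {1..n} \<subseteq> I"
  using index by auto

lemma rectangle_in_sets:
  assumes n: "n \<in> \<N>" and A: "\<And>k. k \<in> {1..n} \<Longrightarrow> A k \<in> sets (borel_of Z)"
  shows "rectangle Z I n A \<in> sets (borel_of K)"
proof -
  have "{x \<in> space (borel_of K). x k \<in> A k} \<in> sets (borel_of K)" if k: "k \<in> {1..n}" for k
    using measurable_sets [OF coordinate_measurable A [OF k]] k interval_subset_index [OF n]
    by (auto simp: vimage_def Int_def conj_commute)
  then have "{x \<in> space (borel_of K). \<forall>k\<in>{1..n}. x k \<in> A k} \<in> sets (borel_of K)"
    by (intro sets.sets_Collect_finite_All) auto
  then show ?thesis by (simp add: rectangle_def)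
qed

text \<open>The lower bound \<open>m\<close> ensures that a permutation of \<open>{1..m}\<close>
  permutes all the coordinates \<open>{1..n}\<close> of a rectangle, so exchangeability up to
  \<open>n\<close> applies to it. Padding with the whole space shows that long rectangles still
  generate the Borel sets.\<close>

definition rectangles :: "nat \<Rightarrow> (nat \<Rightarrow> 'a) set set" where
  "rectangles m = {rectangle Z I n A | n A. n \<in> \<N> \<and> m \<le> n \<and> (\<forall>k. A k \<in> sets (borel_of Z))}"

lemma rectanglesI:
  "n \<in> \<N> \<Longrightarrow> m \<le> n \<Longrightarrow> (\<And>k. A k \<in> sets (borel_of Z)) \<Longrightarrow> rectangle Z I n A \<in> rectangles m"
  by (auto simp: rectangles_def)

lemma rectangles_subset: "rectangles m \<subseteq> Pow (topspace K)"
  by (auto simp: rectangles_def rectangle_def)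

lemma topspace_in_rectangles:
  assumes "m \<in> \<N>"
  shows "topspace K \<in> rectangles m"
proof -
  have "rectangle Z I m (\<lambda>_. topspace Z) = topspace K"
    using interval_subset_index [OF assms] unfolding rectangle_def by fastforce
  moreover have "rectangle Z I m (\<lambda>_. topspace Z) \<in> rectangles m"
    using sets.top [of "borel_of Z"] by (intro rectanglesI assms) auto
  ultimately show ?thesis by simp
qed

lemma rectangle_pad:
  assumes "n \<in> \<N>" "n' \<in> \<N>" "n \<le> n'"
  shows "rectangle Z I n A = rectangle Z I n' (\<lambda>k. if k \<le> n then A k else topspace Z)"
proof -
  have "x k \<in> topspace Z" if "x \<in> topspace K" "k \<in> {1..n'}" for x k
    using that interval_subset_index [OF assms(2)] by auto
  then show ?thesis
    using assms(3) unfolding rectangle_def by (auto simp del: topspace_product_topology)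
qed

lemma Int_stable_rectangles: "Int_stable (rectangles m)"
proof (rule Int_stableI)
  fix a b assume "a \<in> rectangles m" "b \<in> rectangles m"
  then obtain n A n' A' where a: "a = rectangle Z I n A" "n \<in> \<N>" "m \<le> n" "\<And>k. A k \<in> sets (borel_of Z)"
    and b: "b = rectangle Z I n' A'" "n' \<in> \<N>" "m \<le> n'" "\<And>k. A' k \<in> sets (borel_of Z)"
    by (auto simp: rectangles_def)
  let ?C = "\<lambda>k. (if k \<le> n then A k else topspace Z) \<inter> (if k \<le> n' then A' k else topspace Z)"
  have max: "max n n' \<in> \<N>" using a(2) b(2) by (simp add: max_def)
  have "a \<inter> b = rectangle Z I (max n n') ?C"
    unfolding a(1) b(1) rectangle_pad [OF a(2) max max.cobounded1] rectangle_pad [OF b(2) max max.cobounded2]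
    by (auto simp: rectangle_def)
  also have "\<dots> \<in> rectangles m"
    using a b sets.top [of "borel_of Z"] by (intro rectanglesI max) auto
  finally show "a \<inter> b \<in> rectangles m" .
qed

lemma sets_borel_of_rectangles:
  assumes m: "m \<in> \<N>"
  shows "sets (borel_of K) = sigma_sets (topspace K) (rectangles m)"
proof
  define M where "M = sigma (topspace K) (rectangles m)"
  have spM: "space M = topspace K" and sM: "sets M = sigma_sets (topspace K) (rectangles m)"
    unfolding M_def using rectangles_subset by (simp_all add: space_measure_of sets_measure_of del: topspace_product_topology)
  have coord: "(\<lambda>x. x k) \<in> M \<rightarrow>\<^sub>M borel_of Z" if k: "k \<in> I" for k
  proof (rule measurableI)
    fix x assume "x \<in> space M"
    then show "x k \<in> space (borel_of Z)" using k by (auto simp: spM)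
  next
    fix A assume A: "A \<in> sets (borel_of Z)"
    obtain n1 where n1: "n1 \<in> \<N>" "k \<in> {1..n1}" using k index by auto
    \<comment> \<open>The maximum stays in \<open>\<N>\<close>, reaches coordinate \<open>k\<close>
      and respects the lower bound \<open>m\<close>.\<close>
    define n where "n = max m n1"
    have n: "n \<in> \<N>" "m \<le> n" "k \<in> {1..n}" using n1 m by (auto simp: n_def max_def)
    have "(\<lambda>x. x k) -` A \<inter> space M = rectangle Z I n (\<lambda>j. if j = k then A else topspace Z)"
      using n(3) interval_subset_index [OF n(1)] unfolding spM rectangle_def by (fastforce split: if_splits)
    also have "\<dots> \<in> rectangles m"
      using A sets.top [of "borel_of Z"] by (intro rectanglesI n) auto
    finally show "(\<lambda>x. x k) -` A \<inter> space M \<in> sets M"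
      unfolding sM by (rule sigma_sets.Basic)
  qed
  have "(\<lambda>(k, i) x. if k \<in> I then e i (x k) else 0) p \<in> borel_measurable M" for p
    using measurable_compose [OF coord continuous_map_measurable [OF continuous]]
    by (cases p; cases "fst p \<in> I") auto
  then show "sets (borel_of K) \<subseteq> sigma_sets (topspace K) (rectangles m)"
    unfolding sM [symmetric] by (intro K.sets_borel_of_subset spM)
  have "rectangles m \<subseteq> sets (borel_of K)"
    unfolding rectangles_def by (auto intro: rectangle_in_sets)
  then show "sigma_sets (topspace K) (rectangles m) \<subseteq> sets (borel_of K)"
    using sets.sigma_sets_subset [of "rectangles m" "borel_of K"] by simp
qed

text \<open>Both sides say that the law \<open>?D \<sigma>\<close> of the permuted sequence is
  \<open>P\<close>: exchangeability gives agreement on a pi-system of rectangles, invariance of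
  integrals gives agreement on continuous functions, and each class determines a Borel probability
  measure on \<open>K\<close>.\<close>

lemma exchangeable_iff:
  assumes P: "P \<in> borel_prob K"
  shows "(\<forall>n\<in>\<N>. exchangeable_upto (borel_of Z) n P) \<longleftrightarrow>
    (\<forall>n\<in>\<N>. \<forall>\<sigma>. \<sigma> permutes {1..n} \<longrightarrow>
      (\<forall>f\<in>bounded_continuous K. (\<integral>x. f (reindex \<sigma> I x) \<partial>P) = (\<integral>x. f x \<partial>P)))"
    (is "?exch \<longleftrightarrow> ?inv")
proof -
  interpret P: prob_space P using P by (rule borel_probD)
  have spP: "space P = topspace K" and sP: "sets P = sets (borel_of K)"
    using borel_probD [OF P] by auto
  let ?D = "\<lambda>\<sigma>. distr P (borel_of K) (reindex \<sigma> I)"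
  have meas: "reindex \<sigma> I \<in> P \<rightarrow>\<^sub>M borel_of K" if "n \<in> \<N>" "\<sigma> permutes {1..n}" for n \<sigma>
    unfolding measurable_cong_sets [OF sP refl]
    by (rule continuous_map_measurable_borel_of [OF continuous_map_reindex [OF that]])
  have D: "?D \<sigma> \<in> borel_prob K" if "n \<in> \<N>" "\<sigma> permutes {1..n}" for n \<sigma>
    using P.prob_space_distr [OF meas [OF that]] by (simp add: borel_prob_def)
  have D_int: "(\<integral>x. f x \<partial>?D \<sigma>) = (\<integral>x. f (reindex \<sigma> I x) \<partial>P)"
    if "n \<in> \<N>" "\<sigma> permutes {1..n}" "f \<in> bounded_continuous K" for n \<sigma> f
    using that(3) by (intro integral_distr meas [OF that(1,2)] continuous_map_measurable) (simp add: bounded_continuous_def)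
  have D_rect: "measure (?D \<sigma>) (rectangle Z I m A) = measure P {x \<in> space P. \<forall>k\<in>{1..m}. x (\<sigma> k) \<in> A k}"
    if n: "n \<in> \<N>" "\<sigma> permutes {1..n}" and m: "m \<in> \<N>" and A: "\<And>k. k \<in> {1..m} \<Longrightarrow> A k \<in> sets (borel_of Z)"
    for n m \<sigma> A
  proof -
    have "reindex \<sigma> I x \<in> topspace K" if "x \<in> topspace K" for x
      using continuous_map_image_subset_topspace [OF continuous_map_reindex [OF n]] that by blast
    then have "reindex \<sigma> I -` rectangle Z I m A \<inter> space P = {x \<in> space P. \<forall>k\<in>{1..m}. x (\<sigma> k) \<in> A k}"
      using interval_subset_index [OF m] unfolding spP rectangle_def reindex_def
      by (auto simp: subset_iff simp del: topspace_product_topology)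
    then show ?thesis
      by (simp only: measure_distr [OF meas [OF n] rectangle_in_sets [OF m A]])
  qed
  have rect: "rectangle Z I m A = {x \<in> space P. \<forall>k\<in>{1..m}. x k \<in> A k}" for m A
    unfolding rectangle_def spP ..
  have D_eq: "?D \<sigma> = P" if ex: ?exch and n: "n \<in> \<N>" "\<sigma> permutes {1..n}" for n \<sigma>
  proof (rule measure_eqI_generator_eq [OF Int_stable_rectangles rectangles_subset, where A = "\<lambda>_. topspace K"])
    show "sets (?D \<sigma>) = sigma_sets (topspace K) (rectangles n)" "sets P = sigma_sets (topspace K) (rectangles n)"
      using sP sets_borel_of_rectangles [OF n(1)] by simp_all
    show "range (\<lambda>_. topspace K) \<subseteq> rectangles n"
      using topspace_in_rectangles [OF n(1)] by auto
    interpret D: prob_space "?D \<sigma>" using D [OF n] by (rule borel_probD)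
    show "emeasure (?D \<sigma>) (topspace K) \<noteq> \<infinity>" by simp
    fix R assume "R \<in> rectangles n"
    then obtain m A where R: "R = rectangle Z I m A" and m: "m \<in> \<N>" "n \<le> m"
      and A: "\<And>k. A k \<in> sets (borel_of Z)"
      unfolding rectangles_def by blast
    have "\<sigma> permutes {1..m}"
      using n(2) by (rule permutes_subset) (use m in auto)
    moreover have "exchangeable_upto (borel_of Z) m P"
      using ex m(1) by (rule bspec)
    ultimately have "measure P R = measure P {x \<in> space P. \<forall>k\<in>{1..m}. x (\<sigma> k) \<in> A k}"
      unfolding R rect using A by (intro exchangeable_uptoD)
    also have "\<dots> = measure (?D \<sigma>) R"
      unfolding R by (rule D_rect [OF n m(1) A, symmetric])
    finally have "measure (?D \<sigma>) R = measure P R" ..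
    then show "emeasure (?D \<sigma>) R = emeasure P R"
      by (simp add: D.emeasure_eq_measure P.emeasure_eq_measure)
  qed simp
  show ?thesis
  proof
    assume ?exch
    show ?inv
    proof (intro ballI allI impI)
      fix n \<sigma> f assume *: "n \<in> \<N>" "\<sigma> permutes {1..n}" "f \<in> bounded_continuous K"
      show "(\<integral>x. f (reindex \<sigma> I x) \<partial>P) = (\<integral>x. f x \<partial>P)"
        unfolding D_int [OF *, symmetric] D_eq [OF \<open>?exch\<close> *(1,2)] ..
    qed
  next
    assume inv: ?inv
    show ?exch
      unfolding exchangeable_upto_def
    proof (intro ballI allI impI)
      fix n A \<sigma> assume n: "n \<in> \<N>" and A: "\<forall>k\<in>{1..n}. A k \<in> sets (borel_of Z)" and \<sigma>: "\<sigma> permutes {1..n}"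
      have "?D \<sigma> = P"
        using inv n \<sigma> by (intro borel_prob_eqI [OF K.generated_by_continuous D [OF n \<sigma>] P]) (simp add: D_int)
      then show "measure P {x \<in> space P. \<forall>k\<in>{1..n}. x k \<in> A k} =
          measure P {x \<in> space P. \<forall>k\<in>{1..n}. x (\<sigma> k) \<in> A k}"
        using D_rect [OF n \<sigma> n, of A] A by (simp add: rect)
    qed
  qed
qed

theorem compactin_exchangeable:
  "compactin (weak_topology K) {P \<in> borel_prob K. \<forall>n\<in>\<N>. exchangeable_upto (borel_of Z) n P}"
proof -
  define T where "T = {(\<sigma>, f). f \<in> bounded_continuous K \<and> (\<exists>n\<in>\<N>. \<sigma> permutes {1..n})}"
  have "(\<forall>n\<in>\<N>. exchangeable_upto (borel_of Z) n P) \<longleftrightarrow>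
      (\<forall>t\<in>T. (\<integral>x. snd t (reindex (fst t) I x) \<partial>P) = (\<integral>x. snd t x \<partial>P))"
    if "P \<in> borel_prob K" for P
    unfolding exchangeable_iff [OF that] T_def by auto
  then have "{P \<in> borel_prob K. \<forall>n\<in>\<N>. exchangeable_upto (borel_of Z) n P} =
      {P \<in> topspace (weak_topology K). \<forall>t\<in>T.
        (\<integral>x. snd t (reindex (fst t) I x) \<partial>P) = (\<integral>x. snd t x \<partial>P)}"
    unfolding topspace_weak_topology by (intro Collect_cong conj_cong refl)
  also have "closedin (weak_topology K) \<dots>"
  proof (rule closedin_Collect_Ball_eq)
    fix t assume "t \<in> T"
    then obtain n where f: "snd t \<in> bounded_continuous K" and n: "n \<in> \<N>" "fst t permutes {1..n}"
      by (auto simp: T_def)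
    show "continuous_map (weak_topology K) euclideanreal (\<lambda>P. \<integral>x. snd t x \<partial>P)"
      by (rule continuous_map_integral [OF f])
    \<comment> \<open>Reindexing is continuous, so the permuted test function is again a test
      function and its integral is weakly continuous in \<open>P\<close>.\<close>
    have "continuous_map K euclideanreal (snd t \<circ> reindex (fst t) I)"
      using continuous_map_reindex [OF n] f by (intro continuous_map_compose) (auto simp: bounded_continuous_def)
    then have "(\<lambda>x. snd t (reindex (fst t) I x)) \<in> bounded_continuous K"
      by (intro bounded_continuous_compact_space K.compact) (simp add: comp_def)
    then show "continuous_map (weak_topology K) euclideanreal (\<lambda>P. \<integral>x. snd t (reindex (fst t) I x) \<partial>P)"
      by (rule continuous_map_integral)
  qed
  finally show ?thesis
    using K.compactin_borel_prob by (intro closedin_compact_space) (simp_all add: compact_space_def)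
qed

end

theorem lemma2:
  fixes U :: "(real ^ 'n) set" and Y :: "(real ^ 'm) set" and Q :: "(real ^ 'm) measure"
    and N :: nat
  assumes "U \<in> sets borel" and "Y \<in> sets borel"
    and "Q \<in> borel_prob (top_of_set Y)"
    and "compact U"
  shows "convex_measures (L_EX_fin U Y Q N)
    \<and> compactin (weak_topology (team_topology U Y Q {1..N})) (L_EX_fin U Y Q N)
    \<and> convex_measures (L_EX U Y Q)
    \<and> compactin (weak_topology (team_topology U Y Q {1..})) (L_EX U Y Q)"
proof -
  let ?Z = "policy_topology U Y Q"
  interpret separated_compact ?Z "\<lambda>c M. \<integral>p. coded c p \<partial>M"
    using assms(4,3) by (rule separated_compact_policy_topology)
  interpret fin: exchangeability ?Z "\<lambda>c M. \<integral>p. coded c p \<partial>M" "{1..N}" "{N}"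
    by unfold_locales auto
  interpret inf: exchangeability ?Z "\<lambda>c M. \<integral>p. coded c p \<partial>M" "{1..}" UNIV
    by unfold_locales auto
  have fin_eq: "L_EX_fin U Y Q N = {P \<in> borel_prob (team_topology U Y Q {1..N}).
      \<forall>n\<in>{N}. exchangeable_upto (borel_of ?Z) n P}"
    by (simp add: L_EX_fin_def randomized_policies_def)
  have inf_eq: "L_EX U Y Q = {P \<in> borel_prob (team_topology U Y Q {1..}).
      \<forall>n\<in>UNIV. exchangeable_upto (borel_of ?Z) n P}"
    by (simp add: L_EX_def randomized_policies_def)
  show ?thesis
    unfolding fin_eq inf_eq team_topology_def
    by (intro conjI convex_measures_exchangeable fin.compactin_exchangeable inf.compactin_exchangeable)
qed

end
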